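(* For each positive integer $k$, the smoothed $(6k+2)$-gon is a Pontryagin extremal of the Reinhardt optimal control problem given by a bang-bang control. That is, the state trajectory $(g,X)$ of the smoothed $(6k+2)$-gon satisfies the boundary conditions $g(0)=I_2$, $g(t_f)=R$, $X(t_f)=R^{-1}X(0)R$ and lifts to a Pontryagin extremal $(g,X,\Lambda_1,\Lambda_R,\lambda_{cost},u)$ satisfying the transversality conditions.
   Context: Notation: $\langle X,Y\rangle=\mathrm{trace}(XY)$, $[X,Y]=XY-YX$ on $\mathfrak{sl}_2(\mathbb R)$; $J=\begin{pmatrix}0&-1\\ 1&0\end{pmatrix}$, $R=\exp(J\pi/3)$; $U_T=\{(u_0,u_1,u_2):u_i\ge0,\sum u_i=1\}$ with vertices $\mathbf e_1=(1,0,0),\mathbf e_2=(0,1,0),\mathbf e_3=(0,0,1)$; $Z_u=\begin{pmatrix}\frac{u_1-u_2}{\sqrt3}&\frac{u_0-2u_1-2u_2}{3}\\ u_0&\frac{u_2-u_1}{\sqrt3}\end{pmatrix}$; $\Phi(x+iy)=\begin{pmatrix}x/y&-(x^2+y^2)/y\\ 1/y&-x/y\end{pmatrix}$; $\mathfrak h^\star=\{x+iy:y>0,|x|<1/\sqrt3,x^2+y^2>1/3\}$. Reinhardt optimal control problem: with free terminal time $t_f$ and measurable control $u:[0,t_f]\to U_T$, minimize $-\frac32\int_0^{t_f}\langle J,X\rangle dt$ subject to $g'=gX$, $X'=[P,X]$, $P=Z_u/\langle Z_u,X\rangle$, $g\in\mathrm{SL}_2(\mathbb R)$, $X=\Phi(z)$,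 $z\in\mathfrak h^\star$, $g(0)=I_2$, $g(t_f)=R$, $X(t_f)=R^{-1}X(0)R$. Pontryagin extremal: additionally there are absolutely continuous $\Lambda_1,\Lambda_R\in\mathfrak{sl}_2(\mathbb R)$ with $\langle\Lambda_R,X\rangle=0$ and a constant $\lambda_{cost}\le0$, $(\lambda_{cost},\Lambda_1,\Lambda_R)$ nowhere zero, with $\Lambda_1'=[\Lambda_1,X]$, $\Lambda_R'=[P,\Lambda_R]-\langle\Lambda_R,P\rangle[P,X]+[-\Lambda_1+\frac32\lambda_{cost}J,X]$, such that for almost every $t$ the value $u(t)$ maximizes over $v\in U_T$ the Hamiltonian $\langle\Lambda_1-\frac32\lambda_{cost}J,X\rangle-\langle\Lambda_R,Z_v\rangle/\langle X,Z_v\rangle$, with maximal value $0$. Transversality: $\Lambda_1(t_f)=R^{-1}\Lambda_1(0)R$ and $\Lambda_R(t_f)=R^{-1}\Lambda_R(0)R$. A control is bang-bang if it takes values in the vertices of $U_T$, with discontinuous switching. Smoothed $(6k+2)$-gon: let $\theta_k=\frac{\pi k}{3k+1}$, let $y_0\in(1/\sqrt3,1)$ be determined by $\frac{4}{3y_0^2+1}=2\cos\theta_k$, let $t_{sw}=\frac{\ln(4/(3y_0^2+1))}{\sqrt3\,y_0}$ and $t_f=(3k+1)t_{sw}$. The trajectory $(g,X)$ is the solution of the state equations with $g(0)=I_2$, $X(0)=\Phi(iy_0)$, and piecewise constant control which on the consecutive intervals $[mt_{sw},(m+1)t_{sw}]$, $m=0,1,\dots,3k$, takes the values $\mathbf e_3,\mathbf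 e_1,\mathbf e_2,\mathbf e_3,\mathbf e_1,\mathbf e_2,\dots$ cyclically. *)

theory Defs
  imports "HOL-Analysis.Analysis"
begin

section \<open>Two-by-two real matrices\<close>

type_synonym mat2 = "real ^ 2 ^ 2"

definition mat2 :: "real \<Rightarrow> real \<Rightarrow> real \<Rightarrow> real \<Rightarrow> mat2" where
  "mat2 a b c d = vector [vector [a, b], vector [c, d]]"

definition trace_form :: "mat2 \<Rightarrow> mat2 \<Rightarrow> real" where
  "trace_form X Y = trace (X ** Y)"

definition bracket :: "mat2 \<Rightarrow> mat2 \<Rightarrow> mat2" where
  "bracket X Y = X ** Y - Y ** X"

definition sl2 :: "mat2 set" where
  "sl2 = {X. trace X = 0}"

definition SL2 :: "mat2 set" where
  "SL2 = {g. det g = 1}"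

text \<open>The library's ring structure on \<open>real ^ 2 ^ 2\<close> is the componentwise one, so powers
  with respect to matrix multiplication are spelled out here.\<close>

definition mat_exp :: "mat2 \<Rightarrow> mat2" where
  "mat_exp A = (\<Sum>n. (1 / fact n) *\<^sub>R (((\<lambda>B. A ** B) ^^ n) (mat 1)))"

definition J_mat :: mat2 where
  "J_mat = mat2 0 (-1) 1 0"

definition R_mat :: mat2 where
  "R_mat = mat_exp ((pi / 3) *\<^sub>R J_mat)"

section \<open>Controls and the state space\<close>

text \<open>A control \<open>(u\<^sub>0, u\<^sub>1, u\<^sub>2)\<close> is stored as \<open>(u $ 1, u $ 2, u $ 3)\<close>, and the
  vertex \<open>e\<^sub>i\<close> is \<open>axis i 1\<close>.\<close>

definition U_T :: "(real ^ 3) set" where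
  "U_T = {u. (\<forall>i. 0 \<le> u $ i) \<and> (\<Sum>i\<in>UNIV. u $ i) = 1}"

definition U_T_vertices :: "(real ^ 3) set" where
  "U_T_vertices = {axis 1 1, axis 2 1, axis 3 1}"

definition Z_mat :: "real ^ 3 \<Rightarrow> mat2" where
  "Z_mat u = mat2 ((u $ 2 - u $ 3) / sqrt 3) ((u $ 1 - 2 * u $ 2 - 2 * u $ 3) / 3)
                  (u $ 1) ((u $ 3 - u $ 2) / sqrt 3)"

definition Phi :: "complex \<Rightarrow> mat2" where
  "Phi z = mat2 (Re z / Im z) (- ((Re z)\<^sup>2 + (Im z)\<^sup>2) / Im z) (1 / Im z) (- Re z / Im z)"

definition h_star :: "complex set" where
  "h_star = {z. Im z > 0 \<and> \<bar>Re z\<bar> < 1 / sqrt 3 \<and> (Re z)\<^sup>2 + (Im z)\<^sup>2 > 1 / 3}"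

definition P_mat :: "real ^ 3 \<Rightarrow> mat2 \<Rightarrow> mat2" where
  "P_mat u X = (1 / trace_form (Z_mat u) X) *\<^sub>R Z_mat u"

section \<open>The Reinhardt optimal control problem and its extremals\<close>

definition abs_cont_on :: "(real \<Rightarrow> 'a::metric_space) \<Rightarrow> real set \<Rightarrow> bool" where
  "abs_cont_on f S \<longleftrightarrow>
     (\<forall>e>0. \<exists>d>0. \<forall>D T. D division_of T \<and> T \<subseteq> S \<and> (\<Sum>K\<in>D. Sup K - Inf K) < d
        \<longrightarrow> (\<Sum>K\<in>D. dist (f (Sup K)) (f (Inf K))) < e)"

text \<open>Admissible processes of the control problem: the control is measurable and the state
  equations are solved in the sense of Caratheodory.\<close>

definition reinhardt_admissible ::
  "real \<Rightarrow> (real \<Rightarrow> real ^ 3) \<Rightarrow> (real \<Rightarrow> mat2) \<Rightarrow> (real \<Rightarrow> mat2) \<Rightarrow> bool" where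
  "reinhardt_admissible tf u g X \<longleftrightarrow>
     0 < tf \<and>
     u \<in> borel_measurable (lebesgue_on {0..tf}) \<and>
     (\<forall>t\<in>{0..tf}. u t \<in> U_T) \<and>
     abs_cont_on g {0..tf} \<and> abs_cont_on X {0..tf} \<and>
     (\<forall>t\<in>{0..tf}. g t \<in> SL2) \<and>
     (\<forall>t\<in>{0..tf}. \<exists>z\<in>h_star. X t = Phi z) \<and>
     (AE t in lebesgue_on {0..tf}.
        (g has_vector_derivative (g t ** X t)) (at t within {0..tf})) \<and>
     (AE t in lebesgue_on {0..tf}.
        (X has_vector_derivative bracket (P_mat (u t) (X t)) (X t)) (at t within {0..tf})) \<and>
     g 0 = mat 1 \<and> g tf = R_mat \<and>
     X tf = matrix_inv R_mat ** X 0 ** R_mat"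

definition hamiltonian ::
  "real \<Rightarrow> mat2 \<Rightarrow> mat2 \<Rightarrow> mat2 \<Rightarrow> real ^ 3 \<Rightarrow> real" where
  "hamiltonian lcost L1 LR X v =
     trace_form (L1 - (3 / 2 * lcost) *\<^sub>R J_mat) X
       - trace_form LR (Z_mat v) / trace_form X (Z_mat v)"

definition pontryagin_extremal ::
  "real \<Rightarrow> (real \<Rightarrow> real ^ 3) \<Rightarrow> (real \<Rightarrow> mat2) \<Rightarrow> (real \<Rightarrow> mat2) \<Rightarrow>
   (real \<Rightarrow> mat2) \<Rightarrow> (real \<Rightarrow> mat2) \<Rightarrow> real \<Rightarrow> bool" where
  "pontryagin_extremal tf u g X L1 LR lcost \<longleftrightarrow>
     reinhardt_admissible tf u g X \<and>
     abs_cont_on L1 {0..tf} \<and> abs_cont_on LR {0..tf} \<and>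
     (\<forall>t\<in>{0..tf}. L1 t \<in> sl2 \<and> LR t \<in> sl2 \<and> trace_form (LR t) (X t) = 0) \<and>
     lcost \<le> 0 \<and>
     (\<forall>t\<in>{0..tf}. (lcost, L1 t, LR t) \<noteq> (0, 0, 0)) \<and>
     (AE t in lebesgue_on {0..tf}.
        (L1 has_vector_derivative bracket (L1 t) (X t)) (at t within {0..tf})) \<and>
     (AE t in lebesgue_on {0..tf}.
        (let P = P_mat (u t) (X t) in
         (LR has_vector_derivative
            (bracket P (LR t) - trace_form (LR t) P *\<^sub>R bracket P (X t)
             + bracket (- L1 t + (3 / 2 * lcost) *\<^sub>R J_mat) (X t))) (at t within {0..tf}))) \<and>
     (AE t in lebesgue_on {0..tf}.
        (\<forall>v\<in>U_T. hamiltonian lcost (L1 t) (LR t) (X t) v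
                  \<le> hamiltonian lcost (L1 t) (LR t) (X t) (u t)) \<and>
        hamiltonian lcost (L1 t) (LR t) (X t) (u t) = 0)"

definition transversality :: "real \<Rightarrow> (real \<Rightarrow> mat2) \<Rightarrow> (real \<Rightarrow> mat2) \<Rightarrow> bool" where
  "transversality tf L1 LR \<longleftrightarrow>
     L1 tf = matrix_inv R_mat ** L1 0 ** R_mat \<and>
     LR tf = matrix_inv R_mat ** LR 0 ** R_mat"

text \<open>Here \<open>s\<close> lists the switching times (together with the two endpoints) and \<open>v i\<close> is the
  vertex in use between \<open>s i\<close> and \<open>s (i + 1)\<close>; the value jumps at every interior \<open>s i\<close>.\<close>

definition bang_bang :: "real \<Rightarrow> (real \<Rightarrow> real ^ 3) \<Rightarrow> bool" where
  "bang_bang tf u \<longleftrightarrow>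
     (\<forall>t\<in>{0..tf}. u t \<in> U_T_vertices) \<and>
     (\<exists>n s v. s 0 = 0 \<and> s n = tf \<and> (\<forall>i<n. s i < s (Suc i)) \<and>
        (\<forall>i<n. \<forall>t\<in>{s i<..<s (Suc i)}. u t = v i) \<and>
        (\<forall>i. Suc i < n \<longrightarrow> v i \<noteq> v (Suc i)))"

section \<open>The smoothed (6k+2)-gon\<close>

definition theta :: "nat \<Rightarrow> real" where
  "theta k = pi * real k / (3 * real k + 1)"

definition y_init :: "nat \<Rightarrow> real" where
  "y_init k = (THE y. 1 / sqrt 3 < y \<and> y < 1 \<and> 4 / (3 * y\<^sup>2 + 1) = 2 * cos (theta k))"

definition t_switch :: "nat \<Rightarrow> real" where
  "t_switch k = ln (4 / (3 * (y_init k)\<^sup>2 + 1)) / (sqrt 3 * y_init k)"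

definition t_final :: "nat \<Rightarrow> real" where
  "t_final k = (3 * real k + 1) * t_switch k"

definition stage_vertex :: "nat \<Rightarrow> real ^ 3" where
  "stage_vertex m = (if m mod 3 = 0 then axis 3 1 else if m mod 3 = 1 then axis 1 1 else axis 2 1)"

text \<open>Right-continuous at the switching times; the minimum makes the terminal time belong to
  the last interval.\<close>

definition polygon_control :: "nat \<Rightarrow> real \<Rightarrow> real ^ 3" where
  "polygon_control k t = stage_vertex (min (nat \<lfloor>t / t_switch k\<rfloor>) (3 * k))"

text \<open>On each closed interval of constancy the state equations hold classically (one-sided
  derivatives at the ends); as consecutive intervals share an endpoint, this includes
  continuity at the switching times.\<close>

definition polygon_trajectory :: "nat \<Rightarrow> (real \<Rightarrow> mat2) \<Rightarrow> (real \<Rightarrow> mat2) \<Rightarrow> bool" where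
  "polygon_trajectory k g X \<longleftrightarrow>
     g 0 = mat 1 \<and> X 0 = Phi (Complex 0 (y_init k)) \<and>
     (\<forall>m\<le>3 * k. \<forall>t\<in>{real m * t_switch k..real (Suc m) * t_switch k}.
        (g has_vector_derivative (g t ** X t))
          (at t within {real m * t_switch k..real (Suc m) * t_switch k}) \<and>
        (X has_vector_derivative bracket (P_mat (stage_vertex m) (X t)) (X t))
          (at t within {real m * t_switch k..real (Suc m) * t_switch k}))"

end

theory Submission
  imports Defs
begin

text \<open>On each stage the control is constant, so \<open>P\<close> is constant and all state variables are explicit in
  \<open>w = exp (\<surd>3 y t)\<close>, which runs from \<open>1\<close> to \<open>\<alpha> = 2 cos \<theta>\<close>. At the end of a stage \<open>X\<close> has been rotated by
  \<open>R\<^sup>-\<^sup>1\<close>, which also permutes the vertices cyclically; hence \<open>X\<close>, \<open>\<Lambda>\<^sub>1\<close> and \<open>\<Lambda>\<^sub>R\<close> on the stage \<open>m\<close> are the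
  conjugates by \<open>R\<^sup>m\<close> of their restrictions to the first stage. The holonomy \<open>M = g(t\<^sub>s\<^sub>w) R\<^sup>-\<^sup>1\<close> has determinant
  \<open>1\<close> and trace \<open>\<alpha>\<close>, so \<open>M\<^sup>3\<^sup>k\<^sup>+\<^sup>1 = \<plusminus> I\<close>, which gives \<open>g(t\<^sub>f) = R\<close>.
  The costates solve explicit linear equations, and the maximum principle becomes a scalar inequality in
  \<open>w \<in> [1, \<alpha>]\<close>: a function whose derivative changes sign at most once, from negative to positive, is
  non-positive because it is so at both endpoints. At \<open>w = \<alpha>\<close> this follows from
  \<open>ln \<alpha> \<ge> 2 (\<alpha> - 1) / (\<alpha> + 1)\<close>.\<close>

section \<open>Matrices and rotations\<close>

text \<open>Two obstacles shape the argument. The trajectory is known only through its differential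
  equation, whose right side is rational in X. The pairing of X with the active vertex matrix is
  conserved, so every solution obeys a linear equation on each stage, and uniqueness needs no
  Lipschitz estimate for the vector field. Two inactive vertices then compete with the active one,
  but each stage has a time reversal, w -> \<alpha> / w. It fixes the pairing q of the costate with
  X, changes the sign of the other coefficient \<mu> of \<Lambda>_R and exchanges the two inactive
  vertices, so one scalar inequality serves both. The logarithms arise because \<mu> is the integral
  of a function with a constant part, so that time itself enters linearly beside the
  exponentials.\<close>

lemma mat2_nth [simp]:
  "mat2 a b c d $ 1 $ 1 = a" "mat2 a b c d $ 1 $ 2 = b"
  "mat2 a b c d $ 2 $ 1 = c" "mat2 a b c d $ 2 $ 2 = d"
  by (simp_all add: mat2_def)

lemma mat2_eqI:
  assumes "A $ 1 $ 1 = B $ 1 $ 1" "A $ 1 $ 2 = B $ 1 $ 2" "A $ 2 $ 1 = B $ 2 $ 1" "A $ 2 $ 2 = B $ 2 $ 2"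
  shows "A = (B :: mat2)"
  using assms by (simp add: vec_eq_iff forall_2)

lemma mat2_eq_iff [simp]: "mat2 a b c d = mat2 a' b' c' d' \<longleftrightarrow> a = a' \<and> b = b' \<and> c = c' \<and> d = d'"
  by (metis mat2_nth)

lemma mat2_cases: obtains a b c d where "(A :: mat2) = mat2 a b c d"
  by (rule that[of "A$1$1" "A$1$2" "A$2$1" "A$2$2"]) (rule mat2_eqI; simp)

lemma mat2_arith:
  "mat2 a b c d + mat2 a' b' c' d' = mat2 (a + a') (b + b') (c + c') (d + d')"
  "mat2 a b c d - mat2 a' b' c' d' = mat2 (a - a') (b - b') (c - c') (d - d')"
  "- mat2 a b c d = mat2 (- a) (- b) (- c) (- d)"
  "x *\<^sub>R mat2 a b c d = mat2 (x * a) (x * b) (x * c) (x * d)"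
  "mat2 a b c d ** mat2 a' b' c' d' =
     mat2 (a * a' + b * c') (a * b' + b * d') (c * a' + d * c') (c * b' + d * d')"
  by (rule mat2_eqI; simp add: matrix_matrix_mult_def sum_2)+

lemma mat2_one: "mat 1 = mat2 1 0 0 1" and mat2_zero: "0 = mat2 0 0 0 0"
  by (rule mat2_eqI; simp add: mat_def)+

lemma trace_mat2 [simp]: "trace (mat2 a b c d) = a + d"
  by (simp add: trace_def sum_2)

lemma det_mat2 [simp]: "det (mat2 a b c d) = a * d - b * c"
  by (simp add: det_2)

lemmas mat2_simps = mat2_arith mat2_one mat2_zero trace_form_def bracket_def

lemma has_vector_derivative_mat2:
  assumes "(a has_real_derivative a') (at t within S)" "(b has_real_derivative b') (at t within S)"
    "(c has_real_derivative c') (at t within S)" "(d has_real_derivative d') (at t within S)"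
  shows "((\<lambda>t. mat2 (a t) (b t) (c t) (d t)) has_vector_derivative mat2 a' b' c' d') (at t within S)"
proof -
  have dec: "mat2 a b c d = a *\<^sub>R mat2 1 0 0 0 + b *\<^sub>R mat2 0 1 0 0 + c *\<^sub>R mat2 0 0 1 0 + d *\<^sub>R mat2 0 0 0 1"
    for a b c d by (simp add: mat2_simps)
  have scale: "((\<lambda>t. f t *\<^sub>R E) has_vector_derivative f' *\<^sub>R E) (at t within S)"
    if "(f has_real_derivative f') (at t within S)" for f f' and E :: mat2
    using has_vector_derivative_scaleR[OF that has_vector_derivative_const] by simp
  show ?thesis
    by (subst (1 2) dec) (intro has_vector_derivative_add scale assms)
qed

lemma bounded_bilinear_matrix_mult: "bounded_bilinear ((**) :: mat2 \<Rightarrow> mat2 \<Rightarrow> mat2)"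
  unfolding bilinear_conv_bounded_bilinear[symmetric] bilinear_def
proof (intro conjI allI linearI)
  fix x y z :: mat2 and r :: real
  obtain a b c d where x: "x = mat2 a b c d" by (rule mat2_cases)
  obtain a' b' c' d' where y: "y = mat2 a' b' c' d'" by (rule mat2_cases)
  obtain a'' b'' c'' d'' where z: "z = mat2 a'' b'' c'' d''" by (rule mat2_cases)
  show "x ** (y + z) = x ** y + x ** z" "(y + z) ** x = y ** x + z ** x"
    "x ** (r *\<^sub>R y) = r *\<^sub>R (x ** y)" "(r *\<^sub>R y) ** x = r *\<^sub>R (y ** x)"
    by (simp_all add: x y z mat2_arith algebra_simps)
qed

lemmas has_vector_derivative_matrix_mult =
  bounded_bilinear.has_vector_derivative[OF bounded_bilinear_matrix_mult]

lemma bounded_bilinear_trace_form: "bounded_bilinear trace_form"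
  unfolding bilinear_conv_bounded_bilinear[symmetric] bilinear_def
proof (intro conjI allI linearI)
  fix x y z :: mat2 and r :: real
  obtain a b c d where x: "x = mat2 a b c d" by (rule mat2_cases)
  obtain a' b' c' d' where y: "y = mat2 a' b' c' d'" by (rule mat2_cases)
  obtain a'' b'' c'' d'' where z: "z = mat2 a'' b'' c'' d''" by (rule mat2_cases)
  show "trace_form x (y + z) = trace_form x y + trace_form x z"
    "trace_form (y + z) x = trace_form y x + trace_form z x"
    "trace_form x (r *\<^sub>R y) = r *\<^sub>R trace_form x y" "trace_form (r *\<^sub>R y) x = r *\<^sub>R trace_form y x"
    by (simp_all add: x y z mat2_simps algebra_simps)
qed

lemma has_real_derivative_trace_form:
  assumes "(A has_vector_derivative A') (at t within S)" "(B has_vector_derivative B') (at t within S)"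
  shows "((\<lambda>t. trace_form (A t) (B t)) has_real_derivative (trace_form (A t) B' + trace_form A' (B t)))
    (at t within S)"
  unfolding has_real_derivative_iff_has_vector_derivative
  by (rule bounded_bilinear.has_vector_derivative[OF bounded_bilinear_trace_form assms])

lemma trace_form_commute: "trace_form A B = trace_form B A"
  unfolding trace_form_def by (rule trace_mul_sym)

lemma trace_form_bracket_right: "trace_form (bracket A B) B = 0"
  and trace_form_bracket_left: "trace_form (bracket A B) A = 0"
proof -
  obtain a1 a2 a3 a4 where A: "A = mat2 a1 a2 a3 a4" by (rule mat2_cases)
  obtain b1 b2 b3 b4 where B: "B = mat2 b1 b2 b3 b4" by (rule mat2_cases)
  show "trace_form (bracket A B) B = 0" "trace_form (bracket A B) A = 0"
    by (simp_all add: A B mat2_simps algebra_simps)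
qed

lemma bounded_bilinear_bracket: "bounded_bilinear bracket"
  unfolding bilinear_conv_bounded_bilinear[symmetric] bilinear_def
proof (intro conjI allI linearI)
  fix x y z :: mat2 and r :: real
  obtain a b c d where x: "x = mat2 a b c d" by (rule mat2_cases)
  obtain a' b' c' d' where y: "y = mat2 a' b' c' d'" by (rule mat2_cases)
  obtain a'' b'' c'' d'' where z: "z = mat2 a'' b'' c'' d''" by (rule mat2_cases)
  show "bracket x (y + z) = bracket x y + bracket x z" "bracket (y + z) x = bracket y x + bracket z x"
    "bracket x (r *\<^sub>R y) = r *\<^sub>R bracket x y" "bracket (r *\<^sub>R y) x = r *\<^sub>R bracket y x"
    by (simp_all add: x y z mat2_simps algebra_simps)
qed

text \<open>Write W = P + X/2 and N = [P, X]. The matrices X, W, N are mutually orthogonal for the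
  trace form, with <W, W> = <P, P> + 1/2. Since [Q, X] is orthogonal to X, it expands in N and W;
  the coefficients follow from [W, X] = N, [N, X] = -4 W and <N, N> = 4 <W, W>. This puts the
  forcing term of the \<Lambda>_R equation into the basis used for \<Lambda>_R itself.\<close>

lemma bracket_decomposition:
  assumes "trace X = 0" "trace P = 0" "trace Q = 0"
    and XX: "trace_form X X = - 2" and PX: "trace_form P X = 1"
  shows "(trace_form P P + 1 / 2) *\<^sub>R bracket Q X =
    trace_form Q (P + (1 / 2) *\<^sub>R X) *\<^sub>R bracket P X
    - trace_form Q (bracket P X) *\<^sub>R (P + (1 / 2) *\<^sub>R X)"
proof -
  obtain x1 x2 x3 x4 where X: "X = mat2 x1 x2 x3 x4" by (rule mat2_cases)
  obtain p1 p2 p3 p4 where P: "P = mat2 p1 p2 p3 p4" by (rule mat2_cases)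
  obtain q1 q2 q3 q4 where Q: "Q = mat2 q1 q2 q3 q4" by (rule mat2_cases)
  have 4: "x4 = - x1" "p4 = - p1" "q4 = - q1" using assms(1-3) by (simp_all add: X P Q)
  have xx: "x1 * x1 + x2 * x3 = - 1" using XX by (simp add: X 4 mat2_simps)
  have px: "2 * p1 * x1 + p2 * x3 + p3 * x2 = 1" using PX by (simp add: X P 4 mat2_simps)
  show ?thesis
    unfolding X P Q 4 mat2_simps trace_mat2 mat2_eq_iff
    using xx px by (intro conjI; algebra)
qed

section \<open>Rotations and conjugation by powers of R\<close>

definition Rot :: "real \<Rightarrow> mat2" where
  "Rot x = mat2 (cos x) (- sin x) (sin x) (cos x)"

lemma Rot_mult: "Rot x ** Rot y = Rot (x + y)"
  by (simp add: Rot_def mat2_simps cos_add sin_add algebra_simps)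

lemma Rot_zero: "Rot 0 = mat 1"
  by (simp add: Rot_def mat2_one)

text \<open>The matrices a + b J form a copy of the complex numbers, so the matrix exponential
  series is the image of the complex one under the embedding \<open>f\<close>.\<close>

lemma mat_exp_J: "mat_exp (x *\<^sub>R J_mat) = Rot x"
proof -
  define f :: "complex \<Rightarrow> mat2" where "f z = mat2 (Re z) (- Im z) (Im z) (Re z)" for z
  have "linear f"
    by (rule linearI) (simp_all add: f_def mat2_simps)
  then have bl: "bounded_linear f"
    by (rule linear_conv_bounded_linear[THEN iffD1])
  have mult: "f z ** f w = f (z * w)" for z w
    by (simp add: f_def mat2_simps algebra_simps)
  have J: "x *\<^sub>R J_mat = f (\<i> * of_real x)"
    by (simp add: f_def J_mat_def mat2_simps)
  have pow: "((\<lambda>B. f z ** B) ^^ n) (mat 1) = f (z ^ n)" for z n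
    by (induction n) (simp_all add: mult, simp add: f_def mat2_one)
  have "(\<lambda>n. f ((\<i> * of_real x) ^ n /\<^sub>R fact n)) sums f (exp (\<i> * of_real x))"
    by (intro bounded_linear.sums[OF bl] exp_converges)
  moreover have "f (exp (\<i> * of_real x)) = Rot x"
    by (simp add: f_def Rot_def Re_exp Im_exp)
  ultimately show ?thesis
    unfolding mat_exp_def J pow
    by (simp add: sums_iff linear_scale[OF \<open>linear f\<close>] divide_inverse)
qed

lemma R_mat_eq: "R_mat = Rot (pi / 3)"
  by (simp add: R_mat_def mat_exp_J)

lemma R_mat_explicit: "R_mat = mat2 (1 / 2) (- sqrt 3 / 2) (sqrt 3 / 2) (1 / 2)"
  by (simp add: R_mat_eq Rot_def cos_60 sin_60)

text \<open>\<open>matrix_inv\<close> is a choice operator, so uniqueness of the inverse has to be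
  supplied.\<close>

lemma matrix_inv_Rot: "matrix_inv (Rot x) = Rot (- x)"
proof -
  have "A' = Rot (- x)" if "Rot x ** A' = mat 1" for A'
  proof -
    have "A' = (Rot (- x) ** Rot x) ** A'" by (simp add: Rot_mult Rot_zero)
    also have "\<dots> = Rot (- x) ** (Rot x ** A')" by (simp only: matrix_mul_assoc)
    finally show ?thesis by (simp add: that)
  qed
  then show ?thesis
    unfolding matrix_inv_def by (intro some_equality) (auto simp: Rot_mult Rot_zero)
qed

text \<open>Given by angles, which avoids matrix powers; the side of the inverse agrees with the
  terminal condition on X.\<close>

definition conj_rot :: "nat \<Rightarrow> mat2 \<Rightarrow> mat2" where
  "conj_rot m A = Rot (- (real m * pi / 3)) ** A ** Rot (real m * pi / 3)"

lemma Rot_inverse [simp]: "Rot (- x) ** Rot x = mat 1" "Rot x ** Rot (- x) = mat 1"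
  by (simp_all add: Rot_mult Rot_zero)

lemma Rot_cancel [simp]: "Rot (- x) ** (Rot x ** A) = A" "Rot x ** (Rot (- x) ** A) = A"
  by (simp_all add: matrix_mul_assoc)

lemma conj_rot_mult: "conj_rot m A ** conj_rot m B = conj_rot m (A ** B)"
  by (simp only: conj_rot_def matrix_mul_assoc[symmetric] Rot_cancel)

lemma conj_rot_linear: "linear (conj_rot m)"
proof (rule linearI)
  interpret bounded_bilinear "(**) :: mat2 \<Rightarrow> mat2 \<Rightarrow> mat2" by (rule bounded_bilinear_matrix_mult)
  show "conj_rot m (A + B) = conj_rot m A + conj_rot m B" for A B
    by (simp add: conj_rot_def add_left add_right)
  show "conj_rot m (r *\<^sub>R A) = r *\<^sub>R conj_rot m A" for r A
    by (simp add: conj_rot_def scaleR_left scaleR_right)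
qed

lemmas conj_rot_add = linear_add[OF conj_rot_linear]
lemmas conj_rot_diff = linear_diff[OF conj_rot_linear]
lemmas conj_rot_neg = linear_neg[OF conj_rot_linear]
lemmas conj_rot_scale = linear_scale[OF conj_rot_linear]

lemma trace_conj_rot [simp]: "trace (conj_rot m A) = trace A"
  unfolding conj_rot_def
  by (subst trace_mul_sym) (simp only: matrix_mul_assoc Rot_inverse matrix_mul_lid)

lemma det_Rot [simp]: "det (Rot x) = 1"
  by (simp add: Rot_def flip: power2_eq_square)

lemma det_conj_rot [simp]: "det (conj_rot m A) = det A"
  by (simp add: conj_rot_def det_mul)

lemma trace_form_conj_rot [simp]: "trace_form (conj_rot m A) (conj_rot m B) = trace_form A B"
  by (simp add: trace_form_def conj_rot_mult)

lemma bracket_conj_rot: "bracket (conj_rot m A) (conj_rot m B) = conj_rot m (bracket A B)"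
  by (simp add: bracket_def conj_rot_mult conj_rot_diff)

lemma conj_rot_0 [simp]: "conj_rot 0 A = A"
  by (simp add: conj_rot_def Rot_zero)

lemma conj_rot_conj_rot: "conj_rot m (conj_rot n A) = conj_rot (m + n) A"
proof -
  have "conj_rot m (conj_rot n A) =
      (Rot (- (real m * pi / 3)) ** Rot (- (real n * pi / 3))) ** A **
      (Rot (real n * pi / 3) ** Rot (real m * pi / 3))"
    by (simp only: conj_rot_def matrix_mul_assoc)
  also have "\<dots> = conj_rot (m + n) A"
    unfolding Rot_mult conj_rot_def by (simp add: algebra_simps add_divide_distrib)
  finally show ?thesis .
qed

lemma conj_rot_Suc: "conj_rot (Suc m) A = conj_rot m (conj_rot (Suc 0) A)"
  by (simp add: conj_rot_conj_rot)

lemma conj_rot_J [simp]: "conj_rot m J_mat = J_mat"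
proof -
  have "J_mat ** Rot x = Rot x ** J_mat" for x
    by (simp add: Rot_def J_mat_def mat2_arith)
  then show ?thesis
    by (simp only: conj_rot_def matrix_mul_assoc[symmetric] Rot_cancel)
qed

lemma conj_rot_one: "conj_rot (Suc 0) A = matrix_inv R_mat ** A ** R_mat"
  by (simp add: conj_rot_def R_mat_eq matrix_inv_Rot)

lemma conj_rot_one_explicit:
  "conj_rot (Suc 0) A = mat2 (1 / 2) (sqrt 3 / 2) (- sqrt 3 / 2) (1 / 2) ** A **
     mat2 (1 / 2) (- sqrt 3 / 2) (sqrt 3 / 2) (1 / 2)"
  by (simp add: conj_rot_def Rot_def cos_60 sin_60)

lemma Rot_nat_pi: "Rot (real k * pi) = (-1) ^ k *\<^sub>R mat 1"
  by (simp add: Rot_def mat2_simps)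

text \<open>R^3 = -1 is central, so conjugation by it is trivial. This settles the last stage 3k and
  makes \<open>conj_rot (2 * m)\<close> the inverse of \<open>conj_rot m\<close>.\<close>

lemma conj_rot_triple [simp]: "conj_rot (3 * k) A = A"
proof -
  obtain a b c d where A: "A = mat2 a b c d" by (rule mat2_cases)
  have "cos (real (3 * k) * pi / 3) = (-1) ^ k" "sin (real (3 * k) * pi / 3) = 0" by simp_all
  then show ?thesis
    by (simp only: conj_rot_def Rot_def A cos_minus sin_minus mat2_arith)
      (simp flip: power_mult_distrib)
qed

lemma has_vector_derivative_conj_rot:
  "(F has_vector_derivative F') (at t within S) \<Longrightarrow>
   ((\<lambda>t. conj_rot m (F t)) has_vector_derivative conj_rot m F') (at t within S)"
  by (rule bounded_linear.has_vector_derivative[OF linear_conv_bounded_linear[THEN iffD1, OF conj_rot_linear]])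

section \<open>Vertex matrices under rotation, and the star domain\<close>

lemma sqrt3_simps:
  "x / sqrt 3 = x * sqrt 3 / 3" "sqrt 3 * sqrt 3 = 3" "sqrt 3 * (sqrt 3 * x) = 3 * x"
proof -
  have *: "sqrt 3 * sqrt 3 = (3 :: real)" by simp
  show "sqrt 3 * sqrt 3 = 3" by (fact *)
  show "sqrt 3 * (sqrt 3 * x) = 3 * x" by (simp only: mult.assoc[symmetric] *)
  have "x / sqrt 3 = x * sqrt 3 / (sqrt 3 * sqrt 3)" by (simp del: real_sqrt_mult_self)
  then show "x / sqrt 3 = x * sqrt 3 / 3" by (simp only: *)
qed

lemma Z_mat_axis:
  "Z_mat (axis 1 1) = mat2 0 (1 / 3) 1 0"
  "Z_mat (axis 2 1) = mat2 (sqrt 3 / 3) (- 2 / 3) 0 (- sqrt 3 / 3)"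
  "Z_mat (axis 3 1) = mat2 (- sqrt 3 / 3) (- 2 / 3) 0 (sqrt 3 / 3)"
  using sqrt3_simps(1)[of 1] sqrt3_simps(1)[of "-1"] by (simp_all add: Z_mat_def axis_def)

lemma conj_rot_Z:
  "conj_rot (Suc 0) (Z_mat (axis 3 1)) = Z_mat (axis 1 1)"
  "conj_rot (Suc 0) (Z_mat (axis 1 1)) = Z_mat (axis 2 1)"
  "conj_rot (Suc 0) (Z_mat (axis 2 1)) = Z_mat (axis 3 1)"
  by (simp_all add: conj_rot_one_explicit Z_mat_axis mat2_simps sqrt3_simps(2,3) algebra_simps)

text \<open>Rotation permutes the vertex matrices, so comparing with an arbitrary vertex on stage m
  amounts to comparing with some vertex on the first stage.\<close>

lemma Z_mat_eq_conj_rot: "\<exists>j. Z_mat (axis i 1) = conj_rot m (Z_mat (axis j 1))"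
proof (induction m arbitrary: i)
  case (Suc m)
  obtain j where j: "Z_mat (axis i 1) = conj_rot m (Z_mat (axis j 1))" using Suc by blast
  have "\<exists>j'. Z_mat (axis j 1) = conj_rot (Suc 0) (Z_mat (axis j' 1))"
    using exhaust_3[of j] conj_rot_Z by metis
  then show ?case using j by (metis conj_rot_Suc)
qed auto

lemma Z_mat_stage: "Z_mat (stage_vertex m) = conj_rot m (Z_mat (axis 3 1))"
proof (induction m)
  case (Suc m)
  have "Z_mat (stage_vertex (Suc m)) = conj_rot (Suc 0) (Z_mat (stage_vertex m))"
    using conj_rot_Z by (auto simp: stage_vertex_def mod_Suc)
  also have "\<dots> = conj_rot (Suc m) (Z_mat (axis 3 1))"
    by (simp add: Suc conj_rot_conj_rot)
  finally show ?case .
qed (simp add: stage_vertex_def)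

lemma P_mat_stage: "P_mat (stage_vertex m) (conj_rot m X) = conj_rot m (P_mat (axis 3 1) X)"
  by (simp add: P_mat_def Z_mat_stage conj_rot_scale)

lemma Z_mat_convex: "v \<in> U_T \<Longrightarrow> Z_mat v = (\<Sum>i\<in>UNIV. v $ i *\<^sub>R Z_mat (axis i 1))"
  by (simp add: sum_3 Z_mat_axis mat2_simps U_T_def)
     (simp add: Z_mat_def mat2_simps sqrt3_simps field_simps)

text \<open>The walls of \<open>h_star\<close> are the zero sets of the pairings with the vertex
  matrices: e2 and e3 give the two vertical lines, and e1 together with the determinant gives the
  circle.\<close>

lemma Phi_h_starI:
  assumes "trace A = 0" "det A = 1" "\<And>i. trace_form A (Z_mat (axis i 1)) < 0"
  shows "\<exists>z\<in>h_star. A = Phi z"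
proof -
  obtain a b c d where A: "A = mat2 a b c d" by (rule mat2_cases)
  have d: "d = - a" using assms(1) by (simp add: A)
  have det: "a * a + b * c = - 1" using assms(2) by (simp add: A d)
  have e1: "b + c / 3 < 0" and e2: "a * sqrt 3 < c" and e3: "- (a * sqrt 3) < c"
    using assms(3)[of 1] assms(3)[of 2] assms(3)[of 3]
    by (simp_all add: A d Z_mat_axis mat2_simps field_simps)
  have c: "c > 0" using e2 e3 by simp
  define z where "z = Complex (a / c) (1 / c)"
  have "A = Phi z"
    using c arg_cong[OF det, of "\<lambda>u. c * u"] by (simp add: A d Phi_def z_def field_simps power2_eq_square)
  moreover have "z \<in> h_star"
  proof -
    have "sqrt 3 * (a * sqrt 3) < sqrt 3 * c" "sqrt 3 * (- (a * sqrt 3)) < sqrt 3 * c"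
      using e2 e3 by (simp_all only: mult_strict_left_mono real_sqrt_gt_0_iff zero_less_numeral)
    then have "3 * a < sqrt 3 * c" "- 3 * a < sqrt 3 * c"
      by (simp_all add: sqrt3_simps(2,3) mult_ac)
    then have "\<bar>a / c\<bar> < 1 / sqrt 3" using c by (simp add: abs_less_iff sqrt3_simps(1) field_simps)
    moreover have "(a / c)\<^sup>2 + (1 / c)\<^sup>2 > 1 / 3"
    proof -
      have "3 * (b * c) + c * c < 0"
        using mult_strict_right_mono[OF e1 c] by (simp add: algebra_simps)
      then have "3 * (a * a) + 3 > c * c" using det by linarith
      then show ?thesis using c by (simp add: field_simps power2_eq_square)
    qed
    ultimately show ?thesis using c by (simp add: h_star_def z_def)
  qed
  ultimately show ?thesis by blast
qed

section \<open>Piecewise defined trajectories\<close>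

lemma lipschitz_imp_abs_cont_on:
  fixes f :: "real \<Rightarrow> 'a :: metric_space"
  assumes "L-lipschitz_on S f"
  shows "abs_cont_on f S"
  unfolding abs_cont_on_def
proof (intro allI impI)
  fix e :: real assume "0 < e"
  have L: "L \<ge> 0" using assms by (rule lipschitz_on_nonneg)
  show "\<exists>d>0. \<forall>D T. D division_of T \<and> T \<subseteq> S \<and> (\<Sum>K\<in>D. Sup K - Inf K) < d
      \<longrightarrow> (\<Sum>K\<in>D. dist (f (Sup K)) (f (Inf K))) < e"
  \<comment> \<open>The denominator \<open>L + 1\<close> is positive even when
    \<open>L = 0\<close>.\<close>
  proof (intro exI[of _ "e / (L + 1)"] conjI allI impI)
    show "0 < e / (L + 1)" using L \<open>0 < e\<close> by simp
    fix D :: "real set set" and T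
    assume D: "D division_of T \<and> T \<subseteq> S \<and> (\<Sum>K\<in>D. Sup K - Inf K) < e / (L + 1)"
    have K: "Inf K \<in> S \<and> Sup K \<in> S \<and> Inf K \<le> Sup K" if "K \<in> D" for K
    proof -
      obtain a b where ab: "K = cbox a b" using D \<open>K \<in> D\<close> by (meson division_ofD(4))
      have "K \<noteq> {}" "K \<subseteq> T" using D \<open>K \<in> D\<close> by (meson division_ofD)+
      then have "a \<le> b" "K \<subseteq> S" using D by (auto simp: ab)
      then show ?thesis by (auto simp: ab)
    qed
    have "(\<Sum>K\<in>D. dist (f (Sup K)) (f (Inf K))) \<le> (\<Sum>K\<in>D. L * (Sup K - Inf K))"
    proof (rule sum_mono)
      fix K assume "K \<in> D"
      then show "dist (f (Sup K)) (f (Inf K)) \<le> L * (Sup K - Inf K)"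
        using lipschitz_onD[OF assms, of "Sup K" "Inf K"] K[of K] by (simp add: dist_real_def)
    qed
    also have "\<dots> = L * (\<Sum>K\<in>D. Sup K - Inf K)" by (simp add: sum_distrib_left)
    also have "\<dots> \<le> (L + 1) * (\<Sum>K\<in>D. Sup K - Inf K)"
      using K by (intro mult_right_mono sum_nonneg) auto
    also have "\<dots> < e"
      using D L by (simp add: field_simps)
    finally show "(\<Sum>K\<in>D. dist (f (Sup K)) (f (Inf K))) < e" .
  qed
qed

lemma C1_imp_lipschitz_on:
  fixes f :: "real \<Rightarrow> 'a :: real_normed_vector"
  assumes "\<And>t. t \<in> {a..b} \<Longrightarrow> (f has_vector_derivative f' t) (at t within {a..b})"
    and "continuous_on {a..b} f'"
  obtains L where "L-lipschitz_on {a..b} f"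
proof -
  have "bounded (f' ` {a..b})"
    using assms(2) by (intro compact_imp_bounded compact_continuous_image) auto
  then obtain B where B: "B > 0" "\<And>t. t \<in> {a..b} \<Longrightarrow> norm (f' t) \<le> B"
    by (auto simp: bounded_pos)
  have "B-lipschitz_on {a..b} f"
  proof (rule bounded_derivative_imp_lipschitz)
    show "(f has_derivative (\<lambda>h. h *\<^sub>R f' t)) (at t within {a..b})" if "t \<in> {a..b}" for t
      using assms(1)[OF that] by (simp add: has_vector_derivative_def)
    show "onorm (\<lambda>h. h *\<^sub>R f' t) \<le> B" if "t \<in> {a..b}" for t
      using B(2)[OF that] by (intro onorm_le) (simp add: mult.commute[of B] mult_left_mono)
  qed (use B in auto)
  then show thesis by (rule that)
qed

lemma piecewise_lipschitz:
  fixes f :: "real \<Rightarrow> 'a :: metric_space"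
  assumes "0 \<le> T" and "\<And>m. m \<le> n \<Longrightarrow> \<exists>L. L-lipschitz_on {real m * T..real (Suc m) * T} f"
  shows "\<exists>L. L-lipschitz_on {0..real (Suc n) * T} f"
  using assms(2)
proof (induction n)
  case 0
  then show ?case using 0[of 0] by simp
next
  case (Suc n)
  obtain L where L: "L-lipschitz_on {0..real (Suc n) * T} f" using Suc.IH Suc.prems le_Suc_eq by blast
  obtain M where M: "M-lipschitz_on {real (Suc n) * T..real (Suc (Suc n)) * T} f"
    using Suc.prems by blast
  show ?case using lipschitz_on_concat_max[OF L M refl] by auto
qed

lemma piecewise_C1_imp_abs_cont_on:
  fixes f :: "real \<Rightarrow> 'a :: real_normed_vector"
  assumes "0 \<le> T"
    and "\<And>m t. m \<le> n \<Longrightarrow> t \<in> {real m * T..real (Suc m) * T} \<Longrightarrow>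
      (f has_vector_derivative f' m t) (at t within {real m * T..real (Suc m) * T})"
    and "\<And>m. m \<le> n \<Longrightarrow> continuous_on {real m * T..real (Suc m) * T} (f' m)"
  shows "abs_cont_on f {0..real (Suc n) * T}"
proof -
  have "\<exists>L. L-lipschitz_on {0..real (Suc n) * T} f"
  proof (rule piecewise_lipschitz[OF assms(1)])
    fix m assume "m \<le> n"
    then show "\<exists>L. L-lipschitz_on {real m * T..real (Suc m) * T} f"
      using C1_imp_lipschitz_on[OF assms(2)[of m] assms(3)[of m]] by blast
  qed
  then show ?thesis using lipschitz_imp_abs_cont_on by blast
qed

lemma piece_exists:
  assumes "T > 0" "t \<in> {0..real (Suc n) * T}"
  obtains m where "m \<le> n" "t \<in> {real m * T..real (Suc m) * T}"
proof (cases "t = real (Suc n) * T")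
  case True
  then show ?thesis using that[of n] \<open>T > 0\<close> by simp
next
  case False
  then have less: "t / T < real (Suc n)" and nn: "0 \<le> t / T"
    using assms by (auto simp: field_simps)
  define m where "m = nat \<lfloor>t / T\<rfloor>"
  have m: "real m \<le> t / T" "t / T < real (Suc m)" using nn by (simp_all add: m_def) linarith
  then have "m \<le> n" using less by linarith
  moreover have "t \<in> {real m * T..real (Suc m) * T}"
    using m \<open>T > 0\<close> by (simp_all add: field_simps)
  ultimately show ?thesis by (rule that)
qed

text \<open>The equations change at the switching times; these are finitely many, hence a null set,
  so the open pieces suffice.\<close>

lemma AE_piecewise:
  assumes "T > 0"
    and "\<And>m t. m \<le> n \<Longrightarrow> t \<in> {real m * T<..<real (Suc m) * T} \<Longrightarrow> Q t"
  shows "AE t in lebesgue_on {0..real (Suc n) * T}. Q t"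
proof -
  let ?N = "(\<lambda>m. real m * T) ` {..Suc n}"
  have AE: "AE t in lebesgue. t \<notin> ?N"
    by (intro AE_not_in null_sets_completionI finite_imp_null_set_lborel) simp
  have Q: "Q t" if t: "t \<in> {0..real (Suc n) * T}" "t \<notin> ?N" for t
  proof -
    obtain m where m: "m \<le> n" "t \<in> {real m * T..real (Suc m) * T}"
      using piece_exists[OF \<open>T > 0\<close> t(1)] by blast
    have "real m * T \<in> ?N" "real (Suc m) * T \<in> ?N"
      by (rule imageI, use m(1) in simp)+
    then have "t \<noteq> real m * T" "t \<noteq> real (Suc m) * T" using t(2) by metis+
    then have "t \<in> {real m * T<..<real (Suc m) * T}"
      using m(2) unfolding atLeastAtMost_iff greaterThanLessThan_iff by linarith
    then show ?thesis using assms(2) m(1) by blast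
  qed
  have "AE t in lebesgue. t \<in> {0..real (Suc n) * T} \<longrightarrow> Q t"
    using AE by (rule eventually_mono) (rule impI, erule Q)
  then show ?thesis
    by (simp add: AE_restrict_space_iff)
qed

lemma has_vector_derivative_piece_interior:
  assumes "(f has_vector_derivative D) (at t within {real m * T..real (Suc m) * T})"
    and "t \<in> {real m * T<..<real (Suc m) * T}" "m \<le> n" "T > 0"
  shows "(f has_vector_derivative D) (at t within {0..real (Suc n) * T})"
proof -
  have "real (Suc m) * T \<le> real (Suc n) * T"
    using assms(3,4) by (intro mult_right_mono) simp_all
  moreover have "0 \<le> real m * T" using assms(4) by simp
  ultimately have "t \<in> interior {0..real (Suc n) * T}"
    using assms(2) unfolding interior_atLeastAtMost_real greaterThanLessThan_iff by linarith
  moreover have "t \<in> interior {real m * T..real (Suc m) * T}"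
    using assms(2) unfolding interior_atLeastAtMost_real .
  ultimately show ?thesis
    using assms(1) by (simp only: at_within_interior)
qed

section \<open>Gluing stages described in local time\<close>

definition stage_index :: "nat \<Rightarrow> real \<Rightarrow> real \<Rightarrow> nat" where
  "stage_index n T t = min (nat \<lfloor>t / T\<rfloor>) n"

definition glue :: "nat \<Rightarrow> real \<Rightarrow> (nat \<Rightarrow> real \<Rightarrow> 'a) \<Rightarrow> real \<Rightarrow> 'a" where
  "glue n T H t = H (stage_index n T t) (t - real (stage_index n T t) * T)"

lemma stage_index_eq:
  assumes "T > 0" "m \<le> n" "real m * T \<le> t" "t < real (Suc m) * T"
  shows "stage_index n T t = m"
proof -
  have "\<lfloor>t / T\<rfloor> = int m"
    using assms by (intro floor_unique) (simp_all add: field_simps)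
  then show ?thesis using assms(2) by (simp add: stage_index_def)
qed

text \<open>At the right end of a piece the index has already moved to the next stage, so the
  formula of stage m survives there only through the matching condition. At the terminal time the
  minimum in \<open>stage_index\<close> keeps the last stage.\<close>

lemma glue_eq:
  assumes "T > 0" "m \<le> n" "t \<in> {real m * T..real (Suc m) * T}"
    and compat: "\<And>m. m < n \<Longrightarrow> H m T = H (Suc m) 0"
  shows "glue n T H t = H m (t - real m * T)"
proof (cases "t < real (Suc m) * T")
  case True
  then show ?thesis using assms by (simp add: glue_def stage_index_eq)
next
  case False
  then have t: "t = real (Suc m) * T" using assms by simp
  then have "t / T = real (Suc m)" using assms by simp
  then have "nat \<lfloor>t / T\<rfloor> = Suc m" by (simp only: floor_of_nat nat_int)
  then have idx: "stage_index n T t = min (Suc m) n" by (simp only: stage_index_def)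
  show ?thesis
  proof (cases "m < n")
    case True
    then have "stage_index n T t = Suc m" using idx by simp
    then show ?thesis using compat[OF True] by (simp add: glue_def t algebra_simps)
  next
    case False
    then have "stage_index n T t = m" using idx assms(2) by simp
    then show ?thesis by (simp add: glue_def)
  qed
qed

lemma has_vector_derivative_glue:
  assumes "T > 0" "m \<le> n" "t \<in> {real m * T..real (Suc m) * T}"
    and compat: "\<And>m. m < n \<Longrightarrow> H m T = H (Suc m) 0"
    and der: "\<And>s. s \<in> {0..T} \<Longrightarrow> (H m has_vector_derivative H' s) (at s within {0..T})"
  shows "(glue n T H has_vector_derivative H' (t - real m * T))
    (at t within {real m * T..real (Suc m) * T})"
proof (rule has_vector_derivative_transform)
  let ?I = "{real m * T..real (Suc m) * T}"
  show "t \<in> ?I" by fact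
  show "glue n T H s = (H m \<circ> (\<lambda>s. s - real m * T)) s" if "s \<in> ?I" for s
    using glue_eq[of T m n s H, OF assms(1,2) that compat] by simp
  have Suc: "real (Suc m) * T = real m * T + T" by (simp add: algebra_simps)
  have shift: "s - real m * T \<in> {0..T}" if "s \<in> ?I" for s
    using that unfolding Suc atLeastAtMost_iff by linarith
  have "((\<lambda>s. s - real m * T) has_vector_derivative 1) (at t within ?I)"
    by (rule derivative_eq_intros | simp)+
  moreover have "(H m has_vector_derivative H' (t - real m * T))
      (at (t - real m * T) within (\<lambda>s. s - real m * T) ` ?I)"
    by (rule has_vector_derivative_within_subset[OF der[OF shift[OF assms(3)]]]) (use shift in blast)
  ultimately show "(H m \<circ> (\<lambda>s. s - real m * T) has_vector_derivative H' (t - real m * T)) (at t within ?I)"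
    using vector_diff_chain_within[of "\<lambda>s. s - real m * T" 1 t ?I "H m" "H' (t - real m * T)"] by simp
qed

lemma eq_if_zero_vector_derivative:
  fixes f :: "real \<Rightarrow> 'a :: real_normed_vector"
  assumes "\<And>t. t \<in> {a..b} \<Longrightarrow> (f has_vector_derivative 0) (at t within {a..b})"
    and "t \<in> {a..b}"
  shows "f t = f a"
proof -
  obtain c where "\<And>t. t \<in> {a..b} \<Longrightarrow> f t = c"
    using has_vector_derivative_zero_constant[of "{a..b}" f] assms(1) by auto
  then show ?thesis using assms(2) by fastforce
qed

section \<open>The scalar inequality\<close>

text \<open>The hypothesis on b says exactly that the left side vanishes at w = 1, where the
  vertices e2 and e3 tie. The two terms in b w / \<alpha> cancel, which leaves the function
  \<open>E\<close> with the plain term 8 u.\<close>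

lemma max_principle_inequality:
  fixes \<alpha> b w :: real
  assumes \<alpha>: "1 < \<alpha>" "\<alpha> < 2" and w: "1 \<le> w" "w \<le> \<alpha>"
    and b: "4 * (4 - \<alpha>) * b = 4 * ln \<alpha> + 8 - \<alpha> - \<alpha>\<^sup>2"
  shows "(2 * \<alpha> - 4 * b) * (4 / w + 4 * w / \<alpha>) - 2 * \<alpha> * (4 + \<alpha>) + 8 * \<alpha> * b + 2 * (4 - \<alpha>)
     + 4 * (2 * ln \<alpha> - 4 * ln w + 4 * b * (w / \<alpha> - 1 / w)) \<le> 0"
proof -
  define E where "E u = 8 * u - 16 * ln u + (8 * \<alpha> - 32 * b) / u
    + (8 * ln \<alpha> - 2 * \<alpha> * (4 + \<alpha>) + 8 * \<alpha> * b + 2 * (4 - \<alpha>))" for u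
  have E1: "E 1 = 0"
    using b by (simp add: E_def algebra_simps power2_eq_square)
  have E\<alpha>: "E \<alpha> \<le> 0"
  proof -
    have ln: "2 * (\<alpha> - 1) \<le> ln \<alpha> * (\<alpha> + 1)"
      using ln_inverse_approx_ge[of 1 \<alpha>] \<alpha> by (simp add: field_simps)
    define \<epsilon> where "\<epsilon> = \<alpha> - 1"
    have pos: "2 * (2 * \<alpha> + 2 - \<alpha>\<^sup>2) \<ge> 0"
    proof -
      have "\<alpha> * \<alpha> \<le> 2 * \<alpha>" using \<alpha> by (intro mult_right_mono) simp_all
      then show ?thesis by (simp add: power2_eq_square)
    qed
    \<comment> \<open>Inserting the lower bound for ln \<alpha> and clearing its denominator leaves
      a polynomial inequality, true because the difference factors.\<close>
    have "(8 - \<alpha> - \<alpha>\<^sup>2) * (\<alpha> - 1) * (\<alpha> + 1) \<le> 4 * (\<alpha> - 1) * (2 * \<alpha> + 2 - \<alpha>\<^sup>2)"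
    proof -
      have "4 * (\<alpha> - 1) * (2 * \<alpha> + 2 - \<alpha>\<^sup>2) - (8 - \<alpha> - \<alpha>\<^sup>2) * (\<alpha> - 1) * (\<alpha> + 1)
          = (\<alpha> - 1) ^ 3 * \<alpha>"
        by (simp add: algebra_simps power2_eq_square power3_eq_cube)
      moreover have "(\<alpha> - 1) ^ 3 * \<alpha> \<ge> 0" using \<alpha> by simp
      ultimately show ?thesis by linarith
    qed
    also have "\<dots> \<le> ln \<alpha> * (\<alpha> + 1) * (2 * (2 * \<alpha> + 2 - \<alpha>\<^sup>2))"
      using mult_right_mono[OF ln pos] by (simp add: algebra_simps)
    finally have "(8 - \<alpha> - \<alpha>\<^sup>2) * (\<alpha> - 1) * (\<alpha> + 1) \<le> (2 * ln \<alpha> * (2 * \<alpha> + 2 - \<alpha>\<^sup>2)) * (\<alpha> + 1)"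
      by (simp only: mult_ac)
    then have key: "(8 - \<alpha> - \<alpha>\<^sup>2) * (\<alpha> - 1) \<le> 2 * ln \<alpha> * (2 * \<alpha> + 2 - \<alpha>\<^sup>2)"
      by (rule mult_right_le_imp_le) (use \<alpha> in simp)
    \<comment> \<open>The factor 4 - \<alpha> belongs to b in its defining equation, so multiplying
      by it eliminates b; the factor \<alpha> clears the quotient in \<open>E\<close>.\<close>
    have "(4 - \<alpha>) * \<alpha> * E \<alpha> = 8 * ((8 - \<alpha> - \<alpha>\<^sup>2) * (\<alpha> - 1) - 2 * ln \<alpha> * (2 * \<alpha> + 2 - \<alpha>\<^sup>2))"
    proof -
      have "\<alpha> * E \<alpha> = 8 * \<alpha>\<^sup>2 - 8 * ln \<alpha> * \<alpha> + 8 * \<alpha> - 32 * b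
          + \<alpha> * (- 2 * \<alpha> * (4 + \<alpha>) + 8 * \<alpha> * b + 2 * (4 - \<alpha>))"
        using \<alpha> by (simp add: E_def field_simps power2_eq_square)
      then show ?thesis using b by algebra
    qed
    also have "\<dots> \<le> 0"
      by (rule mult_nonneg_nonpos, simp, subst diff_le_0_iff_le, rule key)
    finally show ?thesis using \<alpha> by (simp add: mult_le_0_iff)
  qed
  have der: "(E has_real_derivative 8 * (u * (u - 2) - \<alpha> + 4 * b) / u\<^sup>2) (at u)" if "u > 0" for u
    unfolding E_def using that
    by (auto intro!: derivative_eq_intros simp: field_simps power2_eq_square)
  have mono: "u * (u - 2) \<le> u' * (u' - 2)" if "1 \<le> u" "u \<le> u'" for u u' :: real
  proof -
    have "u' * (u' - 2) - u * (u - 2) = (u' - u) * (u' + u - 2)" by algebra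
    moreover have "\<dots> \<ge> 0" using that by simp
    ultimately show ?thesis by linarith
  qed
  \<comment> \<open>the numerator of the derivative is increasing on \<open>[1, \<alpha>]\<close>, so the maximum is at an endpoint\<close>
  have "E w \<le> 0"
  proof (cases "w * (w - 2) - \<alpha> + 4 * b \<le> 0")
    case True
    have "E w \<le> E 1"
    proof (rule DERIV_nonpos_imp_nonincreasing[OF w(1)])
      fix u assume u: "1 \<le> u" "u \<le> w"
      have "8 * (u * (u - 2) - \<alpha> + 4 * b) / u\<^sup>2 \<le> 0"
        using mono[OF u] True by (intro divide_nonpos_nonneg) simp_all
      then show "\<exists>d. (E has_real_derivative d) (at u) \<and> d \<le> 0" using der[of u] u(1) by fastforce
    qed
    then show ?thesis using E1 by simp
  next
    case False
    have "E w \<le> E \<alpha>"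
    proof (rule DERIV_nonneg_imp_nondecreasing[OF w(2)])
      fix u assume u: "w \<le> u" "u \<le> \<alpha>"
      have "8 * (u * (u - 2) - \<alpha> + 4 * b) / u\<^sup>2 \<ge> 0"
        using mono[OF w(1) u(1)] False by (intro divide_nonneg_nonneg) simp_all
      then show "\<exists>d. (E has_real_derivative d) (at u) \<and> 0 \<le> d" using der[of u] u(1) w(1) by fastforce
    qed
    then show ?thesis using E\<alpha> by simp
  qed
  also have "E w = (2 * \<alpha> - 4 * b) * (4 / w + 4 * w / \<alpha>) - 2 * \<alpha> * (4 + \<alpha>) + 8 * \<alpha> * b + 2 * (4 - \<alpha>)
     + 4 * (2 * ln \<alpha> - 4 * ln w + 4 * b * (w / \<alpha> - 1 / w))"
    using w \<alpha> by (simp add: E_def field_simps)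
  finally show ?thesis .
qed

text \<open>Time reversal w -> \<alpha> / w preserves 4 / w + 4 w / \<alpha> and negates the final
  bracket. This form handles the vertex e1, the previous one e2.\<close>

lemma max_principle_inequality':
  fixes \<alpha> b w :: real
  assumes \<alpha>: "1 < \<alpha>" "\<alpha> < 2" and w: "1 \<le> w" "w \<le> \<alpha>"
    and b: "4 * (4 - \<alpha>) * b = 4 * ln \<alpha> + 8 - \<alpha> - \<alpha>\<^sup>2"
  shows "(2 * \<alpha> - 4 * b) * (4 / w + 4 * w / \<alpha>) - 2 * \<alpha> * (4 + \<alpha>) + 8 * \<alpha> * b + 2 * (4 - \<alpha>)
     - 4 * (2 * ln \<alpha> - 4 * ln w + 4 * b * (w / \<alpha> - 1 / w)) \<le> 0"
proof -
  have "1 \<le> \<alpha> / w" "\<alpha> / w \<le> \<alpha>" using w \<alpha> by (simp_all add: field_simps)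
  from max_principle_inequality[OF \<alpha> this b] show ?thesis
    using w \<alpha> by (simp add: ln_div field_simps)
qed

section \<open>The first stage\<close>

locale smoothed_stage =
  fixes y \<alpha> :: real
  assumes y: "0 < y" and \<alpha>: "1 < \<alpha>" "\<alpha> < 2" and y_\<alpha>: "3 * y\<^sup>2 * \<alpha> = 4 - \<alpha>"
begin

definition r :: real where "r = sqrt 3"

definition i :: real where "i = 1 / y"
definition T :: real where "T = ln \<alpha> / (r * y)"
definition w :: "real \<Rightarrow> real" where "w s = exp (r * y * s)"
definition v :: "real \<Rightarrow> real" where "v s = exp (- (r * y * s))"

lemma r_pos: "r > 0" by (simp add: r_def)

lemma rr_simps: "r * r = 3" "r * (r * x) = 3 * x"
  by (simp_all add: r_def flip: mult.assoc)

lemma T_pos: "T > 0" using y \<alpha> r_pos by (simp add: T_def)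

lemma i_y: "i * y = 1" and i_pos: "i > 0"
  using y by (simp_all add: i_def)

lemma vw: "v s * w s = 1"
  by (simp add: v_def w_def flip: exp_add)

lemma v_eq: "v s = 1 / w s" using vw[of s] by (metis nonzero_eq_divide_eq mult_zero_right zero_neq_one)

lemma w_pos [simp]: "w s > 0" and v_pos: "v s > 0" by (simp_all add: v_def w_def)

lemma nonzero [simp]: "w s \<noteq> 0" "y \<noteq> 0"
  using y by (simp_all add: w_def)

text \<open>Eliminating v and i turns identities on the first stage into rational identities in
  \<open>w s\<close> and \<open>y\<close> modulo \<open>r * r = 3\<close>. The separate constant
  \<open>r\<close> hides the square root from the simplifier.\<close>

lemmas stage_simps = v_eq i_def field_simps rr_simps

lemma \<alpha>_y: "\<alpha> * (1 + 3 * y * y) = 4"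
  using y_\<alpha> by (simp add: power2_eq_square algebra_simps)

lemma w_0 [simp]: "w 0 = 1" and v_0 [simp]: "v 0 = 1" by (simp_all add: w_def v_def)

lemma w_T: "w T = \<alpha>" using y \<alpha> r_pos by (simp add: w_def T_def)

lemma v_T: "v T = (1 + 3 * y * y) / 4"
proof -
  have "v T = 1 / \<alpha>" by (simp add: v_eq w_T)
  also have "\<dots> = (1 + 3 * y * y) / 4" using \<alpha>_y \<alpha> by (simp add: field_simps)
  finally show ?thesis .
qed

lemma w_bounds: "s \<in> {0..T} \<Longrightarrow> 1 \<le> w s \<and> w s \<le> \<alpha>"
proof -
  assume s: "s \<in> {0..T}"
  then have "0 \<le> r * y * s" "r * y * s \<le> ln \<alpha>"
    using y r_pos by (simp_all add: T_def field_simps)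
  then show ?thesis using \<alpha> by (simp add: w_def ln_ge_iff)
qed

lemma der_w: "(w has_real_derivative r * y * w s) (at s within S)"
  unfolding w_def by (rule derivative_eq_intros refl | simp)+

lemma der_v: "(v has_real_derivative - (r * y * v s)) (at s within S)"
  unfolding v_def by (rule derivative_eq_intros refl | simp)+

section \<open>Explicit state on the first stage\<close>

definition P0 :: mat2 where "P0 = mat2 (r * y / 2) y 0 (- (r * y / 2))"

text \<open>\<open>P0\<close> has eigenvalues \<plusminus> r y / 2, so its adjoint action has
  eigenvalues 0 and \<plusminus> r y; hence the entries are combinations of 1, v and w.\<close>

definition X0 :: "real \<Rightarrow> mat2" where
  "X0 s = mat2 (r * i / 3 * (1 - v s)) (- (i / 3 * (v s - 2 + (1 + 3 * y * y) * w s)))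
     (i * v s) (- (r * i / 3 * (1 - v s)))"

text \<open>From X(s) = exp(s P) X(0) exp(-s P) one gets g(s) = exp(s (P + X(0))) exp(-s P). Here P
  + X(0) is lower triangular, P is upper triangular, and their diagonals agree; this explains the
  constant corner entry.\<close>

definition G0 :: "real \<Rightarrow> mat2" where
  "G0 s = mat2 1 (- (r / 3 * (w s - 1))) (r / 3 * i * i * (1 - v s))
     (1 - i * i / 3 * (w s - 2 + v s))"

definition Gi0 :: "real \<Rightarrow> mat2" where
  "Gi0 s = mat2 (1 - i * i / 3 * (w s - 2 + v s)) (r / 3 * (w s - 1))
     (- (r / 3 * i * i * (1 - v s))) 1"

lemma X0_0: "X0 0 = Phi (Complex 0 y)"
proof -
  have "i / 3 * (1 - 2 + (1 + 3 * y * y)) = y"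
    by (simp add: stage_simps)
  then show ?thesis
    using y by (simp add: X0_def Phi_def i_def power2_eq_square)
qed

lemma tr_X0: "trace (X0 s) = 0" and tr_P0: "trace P0 = 0"
  by (simp_all add: X0_def P0_def)

lemma det_X0: "det (X0 s) = 1"
  by (simp add: X0_def stage_simps)

lemma X0_X0: "trace_form (X0 s) (X0 s) = - 2"
  by (simp add: X0_def mat2_simps stage_simps)

lemma P0_X0: "trace_form P0 (X0 s) = 1"
  by (simp add: X0_def P0_def mat2_simps stage_simps)

lemma P0_P0: "trace_form P0 P0 = 3 * y * y / 2"
  by (simp add: P0_def mat2_simps stage_simps)

lemma P_mat_X0: "P_mat (axis 3 1) (X0 s) = P0"
proof -
  have "trace_form (Z_mat (axis 3 1)) (X0 s) = - (2 / 3) * i"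
    by (simp add: X0_def Z_mat_axis r_def[symmetric] mat2_simps stage_simps)
  then show ?thesis
    using y by (simp add: P_mat_def P0_def Z_mat_axis mat2_simps i_def r_def)
qed

lemma der_X0: "(X0 has_vector_derivative bracket P0 (X0 s)) (at s within S)"
proof -
  have "(X0 has_vector_derivative
      mat2 (r * i / 3 * (r * y * v s)) (- (i / 3 * (- (r * y * v s) + (1 + 3 * y * y) * (r * y * w s))))
        (i * (- (r * y * v s))) (- (r * i / 3 * (r * y * v s)))) (at s within S)"
    unfolding X0_def
    by (intro has_vector_derivative_mat2; (rule derivative_eq_intros der_v der_w refl | simp)+)
  also have "mat2 (r * i / 3 * (r * y * v s)) (- (i / 3 * (- (r * y * v s) + (1 + 3 * y * y) * (r * y * w s))))
        (i * (- (r * y * v s))) (- (r * i / 3 * (r * y * v s))) = bracket P0 (X0 s)"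
    by (simp add: X0_def P0_def mat2_simps stage_simps)
  finally show ?thesis .
qed

lemma der_G0: "(G0 has_vector_derivative G0 s ** X0 s) (at s within S)"
proof -
  have "(G0 has_vector_derivative
      mat2 0 (- (r / 3 * (r * y * w s))) (r / 3 * i * i * (r * y * v s))
        (- (i * i / 3 * (r * y * w s + - (r * y * v s))))) (at s within S)"
    unfolding G0_def
    by (intro has_vector_derivative_mat2; (rule derivative_eq_intros der_v der_w refl | simp)+)
  also have "mat2 0 (- (r / 3 * (r * y * w s))) (r / 3 * i * i * (r * y * v s))
        (- (i * i / 3 * (r * y * w s + - (r * y * v s)))) = G0 s ** X0 s"
    by (simp add: X0_def G0_def mat2_simps stage_simps)
  finally show ?thesis .
qed

lemma der_Gi0: "(Gi0 has_vector_derivative - (X0 s ** Gi0 s)) (at s within S)"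
proof -
  have "(Gi0 has_vector_derivative
      mat2 (- (i * i / 3 * (r * y * w s + - (r * y * v s)))) (r / 3 * (r * y * w s))
        (- (r / 3 * i * i * (r * y * v s))) 0) (at s within S)"
    unfolding Gi0_def
    by (intro has_vector_derivative_mat2; (rule derivative_eq_intros der_v der_w refl | simp)+)
  also have "mat2 (- (i * i / 3 * (r * y * w s + - (r * y * v s)))) (r / 3 * (r * y * w s))
        (- (r / 3 * i * i * (r * y * v s))) 0 = - (X0 s ** Gi0 s)"
    by (simp add: X0_def Gi0_def mat2_simps stage_simps)
  finally show ?thesis .
qed

lemma G0_0: "G0 0 = mat 1" and Gi0_0: "Gi0 0 = mat 1"
  by (simp_all add: G0_def Gi0_def mat2_one)

lemma G0_Gi0: "G0 s ** Gi0 s = mat 1" and Gi0_G0: "Gi0 s ** G0 s = mat 1"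
  by (simp_all add: G0_def Gi0_def mat2_simps stage_simps)

lemma det_G0: "det (G0 s) = 1"
  by (simp add: G0_def stage_simps)

lemma X0_T_eq: "X0 T = mat2 (r * i / 4 * (1 - y * y)) (- (i / 4 * (3 + y * y)))
    (i * (1 + 3 * y * y) / 4) (- (r * i / 4 * (1 - y * y)))"
proof -
  have "v T - 2 + (1 + 3 * y * y) * w T = 3 / 4 * (3 + y * y)"
    unfolding v_T w_T using \<alpha>_y by (simp add: mult.commute field_simps)
  then show ?thesis
    unfolding X0_def by (simp add: v_T) (simp add: field_simps)
qed

lemma X0_0_eq: "X0 0 = mat2 0 (- y) i 0"
  by (simp add: X0_def stage_simps)

text \<open>The stage ends at w = \<alpha>, where v = (1 + 3 y^2) / 4 by the relation between y and
  \<alpha>. The exponentials disappear and an identity in y and r remains.\<close>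

lemma X0_T: "X0 T = conj_rot (Suc 0) (X0 0)"
  by (simp add: X0_T_eq X0_0_eq conj_rot_one_explicit r_def[symmetric] mat2_simps i_def field_simps rr_simps)

text \<open>Keeps the state in the star domain and the denominators of the Hamiltonian negative. The
  bound \<alpha> < 2 acts twice: 1 + 3 y^2 = 4 / \<alpha> > 2 for e1, and w \<le> \<alpha> < 2 for
  e2. The pairing with the active vertex e3 is constant.\<close>

lemma X0_Z_neg:
  assumes s: "s \<in> {0..T}"
  shows "trace_form (X0 s) (Z_mat (axis j 1)) < 0"
proof -
  have 1: "trace_form (X0 s) (Z_mat (axis 1 1)) = i / 3 * (2 - (1 + 3 * y * y) * w s)"
    by (simp add: X0_def Z_mat_axis r_def[symmetric] mat2_simps stage_simps)
  have 2: "trace_form (X0 s) (Z_mat (axis 2 1)) = 2 * i / 3 * (1 - 2 * v s)"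
    by (simp add: X0_def Z_mat_axis r_def[symmetric] mat2_simps stage_simps)
  have 3: "trace_form (X0 s) (Z_mat (axis 3 1)) = - 2 * i / 3"
    by (simp add: X0_def Z_mat_axis r_def[symmetric] mat2_simps stage_simps)
  have w: "1 \<le> w s" "w s \<le> \<alpha>" using w_bounds[OF s] by simp_all
  have "1 + 3 * y * y > 2"
  proof -
    have "2 * \<alpha> < (1 + 3 * y * y) * \<alpha>" using \<alpha>_y \<alpha> by (simp add: mult.commute)
    then show ?thesis using \<alpha> by (simp add: mult_less_cancel_right)
  qed
  then have "2 * 1 < (1 + 3 * y * y) * w s" using w(1) by (intro mult_less_le_imp_less) simp_all
  then have "2 < (1 + 3 * y * y) * w s" by simp
  moreover have "1 < 2 * v s"
    using w \<alpha> w_pos[of s] by (simp add: v_eq field_simps)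
  ultimately show ?thesis
    using exhaust_3[of j] i_pos by (auto simp: 1 2 3 mult_pos_neg)
qed

text \<open>Needed because the theorem speaks of every solution, not only of the explicit one. P is
  a multiple of the active vertex matrix Z, so <Z, [P, X]> = 0 and <Z, X> keeps its initial value;
  this makes the equation for X linear. For g it then suffices that the product with the explicit
  inverse \<open>Gi0\<close> is constant.\<close>

lemma base_uniqueness:
  fixes X g :: "real \<Rightarrow> mat2"
  assumes X: "\<And>s. s \<in> {0..T} \<Longrightarrow>
      (X has_vector_derivative bracket (P_mat (axis 3 1) (X s)) (X s)) (at s within {0..T})"
    and g: "\<And>s. s \<in> {0..T} \<Longrightarrow> (g has_vector_derivative g s ** X s) (at s within {0..T})"
    and init: "X 0 = X0 0" and s: "s \<in> {0..T}"
  shows "X s = X0 s" "g s = g 0 ** G0 s"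
proof -
  interpret mm: bounded_bilinear "(**) :: mat2 \<Rightarrow> mat2 \<Rightarrow> mat2" by (rule bounded_bilinear_matrix_mult)
  interpret tf: bounded_bilinear trace_form by (rule bounded_bilinear_trace_form)
  define Z where "Z = Z_mat (axis 3 1)"
  \<comment> \<open>The scalar c absorbs the denominator of P, which is not yet known to be
    constant.\<close>
  have br: "trace_form A (bracket (c *\<^sub>R A) B) = 0" for A B c
  proof -
    obtain a1 a2 a3 a4 where A: "A = mat2 a1 a2 a3 a4" by (rule mat2_cases)
    obtain b1 b2 b3 b4 where B: "B = mat2 b1 b2 b3 b4" by (rule mat2_cases)
    show ?thesis by (simp add: A B mat2_simps algebra_simps)
  qed
  have Pconst: "P_mat (axis 3 1) (X t) = P0" if t: "t \<in> {0..T}" for t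
  proof -
    have "trace_form Z (X t) = trace_form Z (X 0)"
    proof (rule eq_if_zero_vector_derivative[OF _ t])
      fix u assume "u \<in> {0..T}"
      have "((\<lambda>t. trace_form Z (X t)) has_real_derivative
          trace_form Z (bracket (P_mat (axis 3 1) (X u)) (X u)) + trace_form 0 (X u)) (at u within {0..T})"
        by (rule has_real_derivative_trace_form[OF has_vector_derivative_const X]) fact
      moreover have "trace_form Z (bracket (P_mat (axis 3 1) (X u)) (X u)) = 0"
        unfolding P_mat_def Z_def by (rule br)
      ultimately show "((\<lambda>t. trace_form Z (X t)) has_vector_derivative 0) (at u within {0..T})"
        by (simp only: has_real_derivative_iff_has_vector_derivative tf.zero_left add_0_left)
    qed
    then have "P_mat (axis 3 1) (X t) = P_mat (axis 3 1) (X0 0)"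
      by (simp only: P_mat_def Z_def init)
    then show ?thesis by (simp only: P_mat_X0)
  qed
  define a where "a t = exp (r * y / 2 * t)" for t
  define c where "c t = exp (- (r * y / 2 * t))" for t
  define A where "A t = mat2 (a t) ((a t - c t) * r / 3) 0 (c t)" for t
  define Ai where "Ai t = mat2 (c t) (- ((a t - c t) * r / 3)) 0 (a t)" for t
  have a: "a t \<noteq> 0" and c: "c t = 1 / a t" for t
    unfolding a_def c_def exp_minus by (rule exp_not_eq_zero, rule inverse_eq_divide)
  have da: "(a has_real_derivative r * y / 2 * a t) (at t within S)" for t S
    unfolding a_def by (auto intro!: derivative_eq_intros)
  have dc: "(c has_real_derivative - (r * y / 2 * c t)) (at t within S)" for t S
    unfolding c_def by (auto intro!: derivative_eq_intros)
  have A_Ai: "A t ** Ai t = mat 1" for t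
    by (simp add: A_def Ai_def mat2_simps c a field_simps)
  have dA: "(A has_vector_derivative P0 ** A t) (at t within S)" for t S
  proof -
    have "(A has_vector_derivative mat2 (r * y / 2 * a t) ((r * y / 2 * a t - - (r * y / 2 * c t)) * r / 3)
        0 (- (r * y / 2 * c t))) (at t within S)"
      unfolding A_def
      by (intro has_vector_derivative_mat2; (rule derivative_eq_intros da dc refl | simp)+)
    also have "mat2 (r * y / 2 * a t) ((r * y / 2 * a t - - (r * y / 2 * c t)) * r / 3)
        0 (- (r * y / 2 * c t)) = P0 ** A t"
      by (simp add: A_def P0_def mat2_simps c a field_simps rr_simps)
    finally show ?thesis .
  qed
  have dAi: "(Ai has_vector_derivative - (Ai t ** P0)) (at t within S)" for t S
  proof -
    have "(Ai has_vector_derivative mat2 (- (r * y / 2 * c t)) (- ((r * y / 2 * a t - - (r * y / 2 * c t)) * r / 3))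
        0 (r * y / 2 * a t)) (at t within S)"
      unfolding Ai_def
      by (intro has_vector_derivative_mat2; (rule derivative_eq_intros da dc refl | simp)+)
    also have "mat2 (- (r * y / 2 * c t)) (- ((r * y / 2 * a t - - (r * y / 2 * c t)) * r / 3))
        0 (r * y / 2 * a t) = - (Ai t ** P0)"
      by (simp add: Ai_def P0_def mat2_simps c a field_simps rr_simps)
    finally show ?thesis .
  qed
  \<comment> \<open>\<open>P\<close> is constant along solutions, so conjugating by \<open>exp (t P)\<close> makes them constant\<close>
  have lin: "Y t = A t ** (Ai 0 ** Y 0 ** A 0) ** Ai t"
    if Y: "\<And>t. t \<in> {0..T} \<Longrightarrow> (Y has_vector_derivative bracket P0 (Y t)) (at t within {0..T})"
      and t: "t \<in> {0..T}" for Y t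
  proof -
    have "Ai t ** Y t ** A t = Ai 0 ** Y 0 ** A 0"
    proof (rule eq_if_zero_vector_derivative[where f = "\<lambda>t. Ai t ** Y t ** A t", OF _ t])
      fix u assume u: "u \<in> {0..T}"
      have "((\<lambda>t. Ai t ** Y t ** A t) has_vector_derivative
          Ai u ** Y u ** (P0 ** A u) + (Ai u ** bracket P0 (Y u) + - (Ai u ** P0) ** Y u) ** A u)
          (at u within {0..T})"
        by (intro has_vector_derivative_matrix_mult dA dAi Y u)
      also have "Ai u ** Y u ** (P0 ** A u) + (Ai u ** bracket P0 (Y u) + - (Ai u ** P0) ** Y u) ** A u = 0"
        by (simp add: bracket_def mm.diff_right mm.minus_left mm.diff_left mm.add_left matrix_mul_assoc)
      finally show "((\<lambda>t. Ai t ** Y t ** A t) has_vector_derivative 0) (at u within {0..T})" .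
    qed
    then have "A t ** (Ai 0 ** Y 0 ** A 0) ** Ai t = A t ** (Ai t ** Y t ** A t) ** Ai t" by simp
    also have "\<dots> = (A t ** Ai t) ** Y t ** (A t ** Ai t)" by (simp only: matrix_mul_assoc)
    also have "\<dots> = Y t" by (simp add: A_Ai)
    finally show ?thesis by (rule sym)
  qed
  have X_eq: "X t = X0 t" if t: "t \<in> {0..T}" for t
  proof -
    have "X t = A t ** (Ai 0 ** X 0 ** A 0) ** Ai t"
      using X Pconst by (intro lin t) simp
    also have "\<dots> = X0 t"
      unfolding init by (rule lin[symmetric, OF der_X0 t])
    finally show ?thesis .
  qed
  show "X s = X0 s" by (rule X_eq) fact
  have "g s ** Gi0 s = g 0 ** Gi0 0"
  proof (rule eq_if_zero_vector_derivative[where f = "\<lambda>t. g t ** Gi0 t", OF _ s])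
    fix u assume u: "u \<in> {0..T}"
    have "((\<lambda>t. g t ** Gi0 t) has_vector_derivative g u ** - (X0 u ** Gi0 u) + (g u ** X u) ** Gi0 u)
        (at u within {0..T})"
      by (rule has_vector_derivative_matrix_mult[OF g[OF u] der_Gi0])
    also have "g u ** - (X0 u ** Gi0 u) + (g u ** X u) ** Gi0 u = 0"
      by (simp add: X_eq[OF u] mm.minus_right matrix_mul_assoc)
    finally show "((\<lambda>t. g t ** Gi0 t) has_vector_derivative 0) (at u within {0..T})" .
  qed
  then have "g s ** (Gi0 s ** G0 s) = g 0 ** G0 s"
    by (simp add: matrix_mul_assoc Gi0_0)
  then show "g s = g 0 ** G0 s" by (simp add: Gi0_G0)
qed

end

section \<open>Costates on the first stage\<close>

context smoothed_stage
begin

text \<open>The parameter left free by the symmetries of the costates; both \<open>\<kappa>\<close>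
  and \<open>\<mu>\<close> are affine in it. Its value solves the tie between e2 and e3 at s =
  0.\<close>

definition b :: real where "b = (4 * ln \<alpha> + 8 - \<alpha> - \<alpha>\<^sup>2) / (4 * (4 - \<alpha>))"

text \<open>In terms of w this is 4 / w + 4 w / \<alpha>, invariant under time reversal. The
  pairings of \<Lambda>_1 and of J with X are both affine in it.\<close>

definition F where "F s = 4 * v s + (1 + 3 * y * y) * w s"

text \<open>\<open>C\<close> is a multiple of the traceless part of the holonomy \<open>M = g(t\<^sub>s\<^sub>w) R\<^sup>-\<^sup>1\<close> of one stage; as it
  commutes with \<open>M\<close>, the costate \<open>\<Lambda>\<^sub>1 = g\<^sup>-\<^sup>1 C g\<close> inherits the rotational symmetry of \<open>X\<close>. The scale
  \<open>\<kappa>\<close> is forced (for \<open>\<lambda>\<^sub>c\<^sub>o\<^sub>s\<^sub>t = - 1\<close>) by the tie of two vertices at the switching times.\<close>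

definition \<kappa> :: real where "\<kappa> = i / 2 * (4 + \<alpha> - 4 * b)"

definition C' :: mat2 where "C' = mat2 0 y (- (i * (2 + 3 * y * y - i * i) / 4)) 0"

definition C :: mat2 where "C = \<kappa> *\<^sub>R C'"

definition M :: mat2 where "M = (\<alpha> / 2) *\<^sub>R (mat 1 + (r * y) *\<^sub>R C')"

text \<open>Equals \<kappa> / (4 - \<alpha>), written as a polynomial in i.\<close>

definition \<kappa>h where "\<kappa>h = \<kappa> * (1 + i * i / 3) / 4"

definition L0 :: "real \<Rightarrow> mat2" where "L0 s = Gi0 s ** C ** G0 s"

definition Q where "Q s = L0 s + (3 / 2) *\<^sub>R J_mat"

text \<open>\<open>q = \<langle>Q, X\<rangle>\<close> is the control-free part of the Hamiltonian. Since \<open>\<Lambda>\<^sub>R\<close> is orthogonal to \<open>X\<close>, it is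
  a combination of \<open>[P, X]\<close> and \<open>V\<close>; the vanishing of the Hamiltonian fixes the coefficient of \<open>V\<close>.\<close>

definition q where "q s = \<kappa>h * (F s - 2 * \<alpha>) - i / 2 * (F s - 2)"

text \<open>Antiderivative of the function that the \<Lambda>_R equation prescribes for the
  coefficient of [P, X]. The integration constant 2 ln \<alpha> makes it odd under time reversal, as
  the matching at the end of the stage demands.\<close>

definition \<mu> where
  "\<mu> s = r * i * i / 6 * (2 * ln \<alpha> - 4 * (r * y * s) + 4 * b * ((1 + 3 * y * y) / 4 * w s - v s))"

definition V where "V s = P0 + (1 / 2) *\<^sub>R X0 s"

definition LR0 where "LR0 s = \<mu> s *\<^sub>R bracket P0 (X0 s) + (\<alpha> / 2 * q s) *\<^sub>R V s"

lemma b_eq: "4 * (4 - \<alpha>) * b = 4 * ln \<alpha> + 8 - \<alpha> - \<alpha>\<^sup>2"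
  using \<alpha> by (simp add: b_def)

section \<open>Pairings of the costates and their differential equations\<close>

lemma G0_w: "G0 s = mat2 1 (- (r * (w s - 1) / 3)) (r * (w s - 1) / (3 * y * y * w s))
    (1 - (w s - 1) * (w s - 1) / (3 * y * y * w s))"
  by (simp add: G0_def stage_simps)

lemma Gi0_w: "Gi0 s = mat2 (1 - (w s - 1) * (w s - 1) / (3 * y * y * w s)) (r * (w s - 1) / 3)
    (- (r * (w s - 1) / (3 * y * y * w s))) 1"
  by (simp add: Gi0_def stage_simps)

lemma tr_L0: "trace (L0 s) = 0"
proof -
  have "trace (L0 s) = trace ((G0 s ** Gi0 s) ** C)"
    unfolding L0_def by (subst trace_mul_sym) (simp only: matrix_mul_assoc)
  then show ?thesis by (simp add: G0_Gi0 C_def C'_def mat2_arith)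
qed

lemma tr_Q: "trace (Q s) = 0"
  by (simp add: Q_def trace_add tr_L0 J_mat_def mat2_arith)

text \<open>Since g' = g X, conjugating a constant matrix by g solves the Lax equation.\<close>

lemma der_L0: "(L0 has_vector_derivative bracket (L0 s) (X0 s)) (at s within S)"
proof -
  interpret mm: bounded_bilinear "(**) :: mat2 \<Rightarrow> mat2 \<Rightarrow> mat2" by (rule bounded_bilinear_matrix_mult)
  have "(L0 has_vector_derivative Gi0 s ** C ** (G0 s ** X0 s) + (Gi0 s ** 0 + - (X0 s ** Gi0 s) ** C) ** G0 s)
      (at s within S)"
    unfolding L0_def
    by (intro has_vector_derivative_matrix_mult der_G0 der_Gi0 has_vector_derivative_const)
  also have "Gi0 s ** C ** (G0 s ** X0 s) + (Gi0 s ** 0 + - (X0 s ** Gi0 s) ** C) ** G0 s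
      = bracket (L0 s) (X0 s)"
    by (simp add: L0_def bracket_def mm.minus_left mm.zero_right matrix_mul_assoc)
  finally show ?thesis .
qed

lemma der_Q: "(Q has_vector_derivative bracket (L0 s) (X0 s)) (at s within S)"
  unfolding Q_def using has_vector_derivative_add[OF der_L0 has_vector_derivative_const] by simp

lemma n_nonzero [simp]: "1 + 3 * y * y \<noteq> 0" "1 + y * (y * 3) \<noteq> 0" "3 + y * (y * 9) \<noteq> 0"
    "2 + y * (y * 6) \<noteq> 0"
proof -
  have p: "0 < y * y" using y by simp
  have "3 * y * y = 3 * (y * y)" "y * (y * 3) = 3 * (y * y)" "y * (y * 9) = 9 * (y * y)"
    "y * (y * 6) = 6 * (y * y)" by simp_all
  then show "1 + 3 * y * y \<noteq> 0" "1 + y * (y * 3) \<noteq> 0" "3 + y * (y * 9) \<noteq> 0"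
    "2 + y * (y * 6) \<noteq> 0"
    using p by linarith+
qed

lemma \<alpha>_eq: "\<alpha> = 4 / (1 + 3 * y * y)"
  using \<alpha>_y by (simp add: nonzero_eq_divide_eq)

lemma \<alpha>_i: "\<alpha> * (1 + i * i / 3) = 4 * i * i / 3" "(4 - \<alpha>) * (1 + i * i / 3) = 4"
proof -
  have "\<alpha> * (1 + i * i / 3) = (\<alpha> * (1 + 3 * y * y)) * i * i / 3"
    by (simp add: i_def field_simps)
  then show *: "\<alpha> * (1 + i * i / 3) = 4 * i * i / 3" by (simp only: \<alpha>_y)
  then show "(4 - \<alpha>) * (1 + i * i / 3) = 4" by (simp add: left_diff_distrib)
qed

lemma \<kappa>h: "(4 - \<alpha>) * \<kappa>h = \<kappa>"
proof -
  have "(4 - \<alpha>) * \<kappa>h = \<kappa> * ((4 - \<alpha>) * (1 + i * i / 3)) / 4" by (simp add: \<kappa>h_def)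
  then show ?thesis by (simp add: \<alpha>_i)
qed

lemma \<kappa>h_b: "2 * ((4 - \<alpha>) * \<kappa>h) = i * (4 + \<alpha> - 4 * b)"
  by (simp add: \<kappa>h \<kappa>_def)

lemma L0_X0: "trace_form (L0 s) (X0 s) = \<kappa>h * (F s - 2 * \<alpha>)"
proof -
  have "\<kappa>h * (F s - 2 * \<alpha>) = \<kappa> * ((1 + i * i / 3) / 4 * F s - \<alpha> * (1 + i * i / 3) / 2)"
    by (simp add: \<kappa>h_def field_simps)
  also have "\<dots> = \<kappa> * ((1 + i * i / 3) / 4 * F s - 2 * i * i / 3)"
    by (simp add: \<alpha>_i)
  also have "\<dots> = trace_form (L0 s) (X0 s)"
    by (simp add: L0_def C_def C'_def G0_w Gi0_w X0_def F_def mat2_simps stage_simps)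
  finally show ?thesis by (rule sym)
qed

lemma L0_P0: "trace_form (L0 s) P0 = \<kappa> - trace_form (L0 s) (X0 s)"
  by (simp add: L0_def C_def C'_def G0_w Gi0_w X0_def P0_def mat2_simps stage_simps)

lemma J_X0: "trace_form J_mat (X0 s) = - (i / 3 * (F s - 2))"
  by (simp add: J_mat_def X0_def F_def mat2_simps stage_simps)

lemma J_P0: "trace_form J_mat P0 = y"
  by (simp add: J_mat_def P0_def mat2_simps)

lemma Q_X0: "trace_form (Q s) (X0 s) = q s"
proof -
  interpret tf: bounded_bilinear trace_form by (rule bounded_bilinear_trace_form)
  show ?thesis by (simp add: Q_def tf.add_left tf.scaleR_left L0_X0 J_X0 q_def)
qed

lemma Q_P0: "trace_form (Q s) P0 = \<kappa> - \<kappa>h * (F s - 2 * \<alpha>) + 3 / 2 * y"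
proof -
  interpret tf: bounded_bilinear trace_form by (rule bounded_bilinear_trace_form)
  show ?thesis by (simp add: Q_def tf.add_left tf.scaleR_left L0_P0 L0_X0 J_P0)
qed

lemma Q_V: "trace_form (Q s) (V s) = \<kappa> - \<kappa>h * (F s - 2 * \<alpha>) + 3 / 2 * y + q s / 2"
proof -
  interpret tf: bounded_bilinear trace_form by (rule bounded_bilinear_trace_form)
  show ?thesis by (simp add: V_def tf.add_right tf.scaleR_right Q_P0 Q_X0)
qed

lemma der_q: "(q has_real_derivative trace_form (Q s) (bracket P0 (X0 s))) (at s within S)"
proof -
  have "((\<lambda>s. trace_form (Q s) (X0 s)) has_real_derivative
      trace_form (Q s) (bracket P0 (X0 s)) + trace_form (bracket (L0 s) (X0 s)) (X0 s)) (at s within S)"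
    by (rule has_real_derivative_trace_form[OF der_Q der_X0])
  then show ?thesis by (simp add: Q_X0 trace_form_bracket_right)
qed

text \<open>Both sides are affine in F. Their coefficients agree by the choice of \<kappa> in terms
  of b and by 3 \<alpha> y = i (4 - \<alpha>).\<close>

lemma der_\<mu>: "(\<mu> has_real_derivative - q s - \<alpha> / 2 * trace_form (Q s) (V s)) (at s within S)"
proof -
  have "(\<mu> has_real_derivative
      r * i * i / 6 * (- (4 * (r * y)) + 4 * b * ((1 + 3 * y * y) / 4 * (r * y * w s) + r * y * v s)))
      (at s within S)"
    unfolding \<mu>_def by (auto intro!: derivative_eq_intros der_w der_v)
  moreover have "r * i * i / 6 * (- (4 * (r * y)) + 4 * b * ((1 + 3 * y * y) / 4 * (r * y * w s) + r * y * v s))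
      = i / 2 * (b * F s - 4)"
    by (simp add: F_def stage_simps)
  moreover have "i / 2 * (b * F s - 4) = - q s - \<alpha> / 2 * trace_form (Q s) (V s)"
  proof -
    have y: "3 * \<alpha> * y = i * (4 - \<alpha>)"
      using y_\<alpha> by (simp add: i_def field_simps power2_eq_square)
    have rel: "2 * ((4 - \<alpha>) * \<kappa>h) - i * (4 + \<alpha> - 4 * b) = 0" using \<kappa>h_b by simp
    have "8 * (i / 2 * (b * F s - 4) - (- q s - \<alpha> / 2 * trace_form (Q s) (V s))) =
        (2 * ((4 - \<alpha>) * \<kappa>h) - i * (4 + \<alpha> - 4 * b)) * F s
        + 2 * (3 * \<alpha> * y - i * (4 - \<alpha>))"
      unfolding Q_V q_def by (simp add: \<kappa>h[symmetric] field_simps)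
    also have "\<dots> = 0" using rel y by simp
    finally show ?thesis by simp
  qed
  ultimately show ?thesis by (simp only:)
qed

lemma V_P0: "trace_form P0 P0 + 1 / 2 = 2 / \<alpha>" "trace_form (V s) P0 = 2 / \<alpha>"
proof -
  interpret tf: bounded_bilinear trace_form by (rule bounded_bilinear_trace_form)
  show "trace_form P0 P0 + 1 / 2 = 2 / \<alpha>"
    unfolding P0_P0 \<alpha>_eq by (simp add: field_simps)
  then show "trace_form (V s) P0 = 2 / \<alpha>"
    using P0_X0[of s] by (simp add: V_def tf.add_left tf.scaleR_left trace_form_commute[of "X0 s"])
qed

lemma V_X0: "trace_form (V s) (X0 s) = 0"
proof -
  interpret tf: bounded_bilinear trace_form by (rule bounded_bilinear_trace_form)
  show ?thesis by (simp add: V_def tf.add_left tf.scaleR_left P0_X0 X0_X0)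
qed

lemma LR0_X0: "trace_form (LR0 s) (X0 s) = 0"
proof -
  interpret tf: bounded_bilinear trace_form by (rule bounded_bilinear_trace_form)
  show ?thesis
    by (simp add: LR0_def tf.add_left tf.scaleR_left V_X0 trace_form_bracket_right)
qed

lemma LR0_P0: "trace_form (LR0 s) P0 = q s"
proof -
  interpret tf: bounded_bilinear trace_form by (rule bounded_bilinear_trace_form)
  show ?thesis
    using \<alpha> by (simp add: LR0_def tf.add_left tf.scaleR_left V_P0 trace_form_bracket_left)
qed

lemma tr_LR0: "trace (LR0 s) = 0"
proof -
  have "trace (c *\<^sub>R A) = c * trace A" for c and A :: mat2
    by (simp add: trace_def sum_distrib_left)
  then show ?thesis
    by (simp add: LR0_def V_def trace_add tr_P0 tr_X0 bracket_def trace_sub trace_mul_sym[of P0])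
qed

definition LR0' where
  "LR0' s = bracket P0 (LR0 s) - trace_form (LR0 s) P0 *\<^sub>R bracket P0 (X0 s) + bracket (- Q s) (X0 s)"

text \<open>In the basis N = [P, X] and V one has [P, V] = N / 2, and
  \<open>bracket_decomposition\<close> expands [Q, X] with <V, V> = 2 / \<alpha>. The terms \<mu>
  [P, N] agree on both sides, the coefficients of N give the equation for \<mu>, and those of V give
  the derivative of q.\<close>

lemma der_LR0: "(LR0 has_vector_derivative LR0' s) (at s within S)"
proof -
  interpret br: bounded_bilinear bracket by (rule bounded_bilinear_bracket)
  let ?N = "bracket P0 (X0 s)"
  have N: "((\<lambda>s. bracket P0 (X0 s)) has_vector_derivative bracket P0 ?N) (at s within S)"
    using br.has_vector_derivative[OF has_vector_derivative_const der_X0] by (simp add: br.zero_left)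
  have V: "(V has_vector_derivative (1 / 2) *\<^sub>R ?N) (at s within S)"
    unfolding V_def
    using has_vector_derivative_add[OF has_vector_derivative_const
        has_vector_derivative_scaleR[OF DERIV_const der_X0], of "P0" "1/2"] by simp
  have "(LR0 has_vector_derivative
      (\<mu> s *\<^sub>R bracket P0 ?N + (- q s - \<alpha> / 2 * trace_form (Q s) (V s)) *\<^sub>R ?N)
      + ((\<alpha> / 2 * q s) *\<^sub>R (1 / 2) *\<^sub>R ?N + (\<alpha> / 2 * trace_form (Q s) ?N) *\<^sub>R V s)) (at s within S)"
    unfolding LR0_def
    by (intro has_vector_derivative_add has_vector_derivative_scaleR N V der_\<mu> DERIV_cmult der_q)
  also have "(\<mu> s *\<^sub>R bracket P0 ?N + (- q s - \<alpha> / 2 * trace_form (Q s) (V s)) *\<^sub>R ?N)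
      + ((\<alpha> / 2 * q s) *\<^sub>R (1 / 2) *\<^sub>R ?N + (\<alpha> / 2 * trace_form (Q s) ?N) *\<^sub>R V s) = LR0' s"
  proof -
    have "(2 / \<alpha>) *\<^sub>R bracket (Q s) (X0 s) =
        trace_form (Q s) (V s) *\<^sub>R ?N - trace_form (Q s) ?N *\<^sub>R V s"
      using bracket_decomposition[OF tr_X0 tr_P0 tr_Q X0_X0 P0_X0] by (simp only: V_P0 V_def)
    then have "(\<alpha> / 2) *\<^sub>R (2 / \<alpha>) *\<^sub>R bracket (Q s) (X0 s) =
        (\<alpha> / 2) *\<^sub>R (trace_form (Q s) (V s) *\<^sub>R ?N - trace_form (Q s) ?N *\<^sub>R V s)" by simp
    then have QX: "bracket (Q s) (X0 s) =
        (\<alpha> / 2 * trace_form (Q s) (V s)) *\<^sub>R ?N - (\<alpha> / 2 * trace_form (Q s) ?N) *\<^sub>R V s"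
      using \<alpha> by (simp add: scaleR_right_diff_distrib)
    have PV: "bracket P0 (V s) = (1 / 2) *\<^sub>R ?N"
      by (simp add: V_def br.add_right br.scaleR_right) (simp add: bracket_def)
    show ?thesis
      unfolding LR0'_def LR0_P0 br.minus_left QX
      unfolding LR0_def br.add_right br.scaleR_right PV
      by (simp add: algebra_simps)
  qed
  finally show ?thesis .
qed

section \<open>Matching across a switching time\<close>

lemma G0_T: "G0 T = M ** R_mat"
proof -
  have wT: "w T = 4 / (1 + 3 * y * y)" by (rule trans[OF w_T \<alpha>_eq])
  have G: "G0 T = mat2 1 (- (r * (1 - y * y) / (1 + 3 * y * y))) (r * (1 - y * y) / (4 * y * y))
      (1 - 3 * (1 - y * y) * (1 - y * y) / (4 * y * y * (1 + 3 * y * y)))"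
    unfolding G0_def v_T wT by (simp add: i_def divide_simps) (simp add: algebra_simps)
  have M: "M = mat2 (2 / (1 + 3 * y * y)) (2 * r * y * y / (1 + 3 * y * y))
      (r * (1 - 3 * y * y) * (1 + y * y) / (2 * y * y * (1 + 3 * y * y))) (2 / (1 + 3 * y * y))"
  proof -
    have *: "\<alpha> / 2 = 2 / (1 + 3 * y * y)" using \<alpha>_y by (simp add: nonzero_eq_divide_eq)
    show ?thesis
      unfolding M_def C'_def * by (simp add: mat2_simps i_def divide_simps) (simp add: algebra_simps)
  qed
  show ?thesis
    unfolding G M R_mat_explicit r_def[symmetric]
    by (simp add: mat2_simps divide_simps) (simp add: algebra_simps rr_simps)
qed

lemma L0_T: "L0 T = conj_rot (Suc 0) (L0 0)"
proof -
  interpret mm: bounded_bilinear "(**) :: mat2 \<Rightarrow> mat2 \<Rightarrow> mat2" by (rule bounded_bilinear_matrix_mult)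
  have comm: "C ** M = M ** C"
    by (simp add: C_def M_def mm.scaleR_left mm.scaleR_right mm.add_left mm.add_right scaleR_add_right mult_ac)
  have "L0 T = Gi0 T ** (C ** M) ** R_mat"
    by (simp add: L0_def G0_T matrix_mul_assoc)
  also have "\<dots> = Gi0 T ** (M ** R_mat) ** (matrix_inv R_mat ** C ** R_mat)"
    unfolding comm by (simp only: R_mat_eq matrix_inv_Rot matrix_mul_assoc[symmetric] Rot_cancel)
  also have "\<dots> = conj_rot (Suc 0) C"
    by (simp add: conj_rot_one Gi0_G0 flip: G0_T)
  finally show ?thesis by (simp add: L0_def G0_0 Gi0_0)
qed

text \<open>This is the tie of e2 and e3 at the start of the stage, and it holds by the value of b.
  It makes \<Lambda>_R(0) a multiple of V - (r y / 2) [P, X], the direction that rotation carries to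
  the end of the stage.\<close>

lemma \<mu>_0: "\<mu> 0 = - (r * y / 2) * (\<alpha> / 2 * q 0)"
proof -
  have F0: "F 0 = 4 + (1 + 3 * y * y)" by (simp add: F_def)
  define n where "n = 1 + 3 * y * y"
  have n: "n * \<alpha> - 4 = 0" using \<alpha>_y by (simp add: n_def mult.commute)
  have yi: "y * i = 1" using i_y by (simp add: mult.commute)
  have "2 * (y * ((4 - \<alpha>) * q 0)) = (y * i) * (4 + \<alpha> - 4 * b) * (4 + n - 2 * \<alpha>) - (y * i) * (4 - \<alpha>) * (2 + n)"
  proof -
    have "2 * (y * ((4 - \<alpha>) * q 0)) = y * (2 * ((4 - \<alpha>) * \<kappa>h)) * (4 + n - 2 * \<alpha>) - y * i * (4 - \<alpha>) * (2 + n)"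
      by (simp add: q_def F0 n_def field_simps)
    then show ?thesis unfolding \<kappa>h_b by (simp only: mult_ac)
  qed
  also have "\<dots> = - 4 * (2 * ln \<alpha> + b * (n - 4)) + (n * \<alpha> - 4) * 2
      + 2 * (4 * ln \<alpha> + 8 - \<alpha> - \<alpha>\<^sup>2 - 4 * (4 - \<alpha>) * b)"
    unfolding yi by (simp add: algebra_simps power2_eq_square)
  also have "\<dots> = - 4 * (2 * ln \<alpha> + b * (n - 4))"
    unfolding n using b_eq by simp
  finally have key: "2 * ln \<alpha> + b * (n - 4) = - (y * ((4 - \<alpha>) * q 0)) / 2" by simp
  have "\<mu> 0 = r * i * i / 6 * (2 * ln \<alpha> + b * (n - 4))"
    by (simp add: \<mu>_def n_def algebra_simps)
  also have "\<dots> = - (r * y / 2) * (\<alpha> / 2 * q 0)"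
    unfolding key y_\<alpha>[symmetric] by (simp add: i_def power2_eq_square field_simps)
  finally show ?thesis .
qed

lemma \<mu>_T: "\<mu> T = - \<mu> 0"
proof -
  have "r * y * T = ln \<alpha>" using y r_pos by (simp add: T_def)
  moreover have "(1 + 3 * y * y) / 4 * \<alpha> = 1" using \<alpha>_y by (simp add: mult.commute)
  ultimately show ?thesis
    unfolding \<mu>_def w_T v_T by (simp add: algebra_simps)
qed

lemma q_T: "q T = q 0"
proof -
  have "F T = F 0" using \<alpha>_y by (simp add: F_def w_T v_T mult.commute)
  then show ?thesis by (simp add: q_def)
qed

text \<open>As \<mu> is odd and q is even under time reversal, both sides carry the common factor
  \<alpha> q(0) / 2; what remains is an identity between explicit matrices.\<close>

lemma LR0_T: "LR0 T = conj_rot (Suc 0) (LR0 0)"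
proof -
  have X: "(r * y / 2) *\<^sub>R bracket P0 (X0 T) + V T = conj_rot (Suc 0) (- (r * y / 2) *\<^sub>R bracket P0 (X0 0) + V 0)"
    unfolding V_def X0_T_eq X0_0_eq P0_def conj_rot_one_explicit r_def[symmetric] mat2_simps mat2_eq_iff i_def
    by (simp add: field_simps rr_simps)
  have "LR0 T = (\<alpha> / 2 * q 0) *\<^sub>R ((r * y / 2) *\<^sub>R bracket P0 (X0 T) + V T)"
    by (simp add: LR0_def \<mu>_T \<mu>_0 q_T algebra_simps)
  also have "\<dots> = conj_rot (Suc 0) (LR0 0)"
    unfolding X conj_rot_scale[symmetric] by (simp add: LR0_def \<mu>_0 algebra_simps)
  finally show ?thesis .
qed

text \<open>Together with \<open>q_w\<close> this brings \<mu> and q to the common scale i / 2, so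
  that their sum and difference take the form of the two scalar inequalities.\<close>

lemma \<mu>_w: "4 * (r * y * \<mu> s) = i / 2 * (4 * (2 * ln \<alpha> - 4 * ln (w s) + 4 * b * (w s / \<alpha> - 1 / w s)))"
proof -
  have "ln (w s) = r * y * s" by (simp add: w_def)
  moreover have "w s / \<alpha> = (1 + 3 * y * y) / 4 * w s" by (simp add: \<alpha>_eq)
  ultimately have "\<mu> s = r * i * i / 6 * (2 * ln \<alpha> - 4 * ln (w s) + 4 * b * (w s / \<alpha> - 1 / w s))"
    by (simp only: \<mu>_def v_eq)
  moreover have "4 * (r * y * (r * i * i / 6 * N)) = i / 2 * (4 * N)" for N
    by (simp add: i_def field_simps rr_simps)
  ultimately show ?thesis by (simp only:)
qed

lemma q_w: "(4 - \<alpha>) * q s = i / 2 * ((2 * \<alpha> - 4 * b) * (4 / w s + 4 * w s / \<alpha>)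
    - 2 * \<alpha> * (4 + \<alpha>) + 8 * \<alpha> * b + 2 * (4 - \<alpha>))"
proof -
  have F: "4 / w s + 4 * w s / \<alpha> = F s" by (simp add: F_def v_eq \<alpha>_eq)
  have "2 * ((4 - \<alpha>) * q s) = 2 * ((4 - \<alpha>) * \<kappa>h) * (F s - 2 * \<alpha>) - (4 - \<alpha>) * i * (F s - 2)"
    by (simp add: q_def field_simps)
  then show ?thesis
    unfolding \<kappa>h_b F by (simp add: field_simps)
qed

section \<open>The maximum principle on the first stage\<close>

lemma hamiltonian_stationary:
  "q s * trace_form (X0 s) (Z_mat (axis 3 1)) - trace_form (LR0 s) (Z_mat (axis 3 1)) = 0"
proof -
  interpret tf: bounded_bilinear trace_form by (rule bounded_bilinear_trace_form)
  have "Z_mat (axis 3 1) = (- (2 * i / 3)) *\<^sub>R P0"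
    by (simp add: Z_mat_axis P0_def r_def[symmetric] mat2_simps i_def)
  then show ?thesis
    using LR0_P0[of s] P0_X0[of s] by (simp add: tf.scaleR_right tf.minus_right trace_form_commute[of "X0 s"])
qed

text \<open>Nonpositivity of the Hamiltonian at a vertex, multiplied by its negative denominator.
  The bound for e2 is sharp at the start of the stage, where the control has just left e2, and the
  bound for e1 is sharp at the end, where the control moves to e1.\<close>

lemma hamiltonian_max:
  assumes s: "s \<in> {0..T}"
  shows "q s * trace_form (X0 s) (Z_mat (axis j 1)) - trace_form (LR0 s) (Z_mat (axis j 1)) \<ge> 0"
proof -
  interpret tf: bounded_bilinear trace_form by (rule bounded_bilinear_trace_form)
  define n where "n = 1 + 3 * y * y"
  have n: "n > 0" by (simp add: n_def add_pos_nonneg)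
  have w: "1 \<le> w s" "w s \<le> \<alpha>" using w_bounds[OF s] by simp_all
  have yi: "y * \<alpha> = i * (4 - \<alpha>) / 3"
    using y_\<alpha> by (simp add: i_def field_simps power2_eq_square)
  have LR: "trace_form (LR0 s) Z = \<mu> s * trace_form (bracket P0 (X0 s)) Z
      + \<alpha> / 2 * q s * (trace_form P0 Z + trace_form (X0 s) Z / 2)" for Z
    by (simp add: LR0_def V_def tf.add_left tf.scaleR_left algebra_simps)
  have split: "q s * trace_form (X0 s) Z - trace_form (LR0 s) Z
      = q s * ((4 - \<alpha>) / 4 * trace_form (X0 s) Z - \<alpha> / 2 * trace_form P0 Z)
        - \<mu> s * trace_form (bracket P0 (X0 s)) Z" for Z
    unfolding LR by (simp add: field_simps)
  consider "j = 1" | "j = 2" | "j = 3" using exhaust_3[of j] by blast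
  then show ?thesis
  proof cases
    case 1
    have XZ: "trace_form (X0 s) (Z_mat (axis 1 1)) = i / 3 * (2 - n * w s)"
      by (simp add: X0_def n_def Z_mat_axis r_def[symmetric] mat2_simps stage_simps)
    have PZ: "trace_form P0 (Z_mat (axis 1 1)) = y"
      by (simp add: P0_def Z_mat_axis mat2_simps)
    have BZ: "trace_form (bracket P0 (X0 s)) (Z_mat (axis 1 1)) = - (i * n * w s * (r * y) / 3)"
      by (simp add: P0_def X0_def n_def Z_mat_axis r_def[symmetric] mat2_simps stage_simps)
    \<comment> \<open>The relation for y \<alpha> cancels the part of the pairings that is constant
      in w, so a positive factor splits off.\<close>
    have eq: "q s * trace_form (X0 s) (Z_mat (axis 1 1)) - trace_form (LR0 s) (Z_mat (axis 1 1))
        = i * n * w s / 12 * (4 * (r * y * \<mu> s) - (4 - \<alpha>) * q s)"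
    proof -
      have \<alpha>y: "\<alpha> / 2 * y = i * (4 - \<alpha>) / 6" using yi by (simp add: mult.commute)
      show ?thesis unfolding split unfolding XZ PZ BZ \<alpha>y by (simp add: field_simps)
    qed
    have "4 * (r * y * \<mu> s) - (4 - \<alpha>) * q s \<ge> 0"
      unfolding \<mu>_w q_w right_diff_distrib[symmetric]
      using max_principle_inequality'[OF \<alpha> w b_eq] i_pos by (intro mult_nonneg_nonneg) simp_all
    moreover have "0 \<le> i * n * w s"
      using i_pos n by (intro mult_nonneg_nonneg) (simp_all add: less_imp_le)
    ultimately show ?thesis
      unfolding 1 eq by (intro mult_nonneg_nonneg) simp_all
  next
    case 2
    have XZ: "trace_form (X0 s) (Z_mat (axis 2 1)) = 2 * i / 3 * (1 - 2 * v s)"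
      by (simp add: X0_def Z_mat_axis r_def[symmetric] mat2_simps stage_simps)
    have PZ: "trace_form P0 (Z_mat (axis 2 1)) = y"
      by (simp add: P0_def Z_mat_axis r_def[symmetric] mat2_simps rr_simps field_simps)
    have BZ: "trace_form (bracket P0 (X0 s)) (Z_mat (axis 2 1)) = 4 * i * v s * (r * y) / 3"
      by (simp add: P0_def X0_def Z_mat_axis r_def[symmetric] mat2_simps stage_simps)
    have eq: "q s * trace_form (X0 s) (Z_mat (axis 2 1)) - trace_form (LR0 s) (Z_mat (axis 2 1))
        = i * v s / 3 * - ((4 - \<alpha>) * q s + 4 * (r * y * \<mu> s))"
    proof -
      have \<alpha>y: "\<alpha> / 2 * y = i * (4 - \<alpha>) / 6" using yi by (simp add: mult.commute)
      show ?thesis unfolding split unfolding XZ PZ BZ \<alpha>y by (simp add: field_simps)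
    qed
    have "- ((4 - \<alpha>) * q s + 4 * (r * y * \<mu> s)) \<ge> 0"
    proof -
      have "(4 - \<alpha>) * q s + 4 * (r * y * \<mu> s) \<le> 0"
        unfolding \<mu>_w q_w distrib_left[symmetric]
        using max_principle_inequality[OF \<alpha> w b_eq] i_pos by (intro mult_nonneg_nonpos) simp_all
      then show ?thesis by simp
    qed
    then show ?thesis
      unfolding 2 eq using i_pos v_pos[of s] by (intro mult_nonneg_nonneg) simp_all
  next
    case 3
    then show ?thesis using hamiltonian_stationary[of s] by simp
  qed
qed

end

section \<open>Gluing the stages\<close>

text \<open>Numerator and denominator of the quotient are linear in the control and the denominator
  is negative on the whole simplex, so after multiplication the claim is a convex combination of its
  instances at the vertices.\<close>

lemma hamiltonian_nonpos:
  assumes X: "\<And>j. trace_form X (Z_mat (axis j 1)) < 0"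
    and L: "\<And>j. c * trace_form X (Z_mat (axis j 1)) - trace_form L (Z_mat (axis j 1)) \<ge> 0"
    and v: "v \<in> U_T"
  shows "c - trace_form L (Z_mat v) / trace_form X (Z_mat v) \<le> 0"
proof -
  interpret tf: bounded_bilinear trace_form by (rule bounded_bilinear_trace_form)
  have lin: "trace_form A (Z_mat v) = (\<Sum>j\<in>UNIV. v $ j * trace_form A (Z_mat (axis j 1)))" for A
    by (simp add: Z_mat_convex[OF v] tf.sum_right tf.scaleR_right)
  have pos: "v $ j \<ge> 0" for j using v by (simp add: U_T_def)
  have sum: "(\<Sum>j\<in>UNIV. v $ j) = 1" using v by (simp add: U_T_def)
  obtain j where j: "v $ j > 0"
  proof -
    have "\<exists>j. v $ j \<noteq> 0" using sum by (metis sum.neutral zero_neq_one)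
    then show thesis using that pos by (metis order_le_less)
  qed
  have "trace_form X (Z_mat v) < (\<Sum>j\<in>(UNIV :: 3 set). 0)"
    unfolding lin
  proof (rule sum_strict_mono_ex1)
    show "\<forall>j\<in>UNIV. v $ j * trace_form X (Z_mat (axis j 1)) \<le> 0"
      using pos X by (simp add: mult_nonneg_nonpos less_imp_le)
    show "\<exists>j\<in>UNIV. v $ j * trace_form X (Z_mat (axis j 1)) < 0"
      using j X by (auto intro: mult_pos_neg)
  qed simp
  then have neg: "trace_form X (Z_mat v) < 0" by simp
  have "0 \<le> (\<Sum>j\<in>UNIV. v $ j * (c * trace_form X (Z_mat (axis j 1)) - trace_form L (Z_mat (axis j 1))))"
    using pos L by (intro sum_nonneg mult_nonneg_nonneg)
  also have "\<dots> = c * trace_form X (Z_mat v) - trace_form L (Z_mat v)"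
    unfolding lin by (simp add: sum_distrib_left right_diff_distrib sum_subtractf mult.left_commute)
  finally show ?thesis using neg by (simp add: field_simps)
qed

lemma stage_vertex_U_T: "stage_vertex m \<in> U_T_vertices" "stage_vertex m \<in> U_T"
  by (auto simp: stage_vertex_def U_T_vertices_def U_T_def sum_3 axis_def)

lemma stage_vertex_Suc_neq: "stage_vertex m \<noteq> stage_vertex (Suc m)"
proof -
  have "axis 1 1 \<noteq> (axis 2 1 :: real ^ 3)" "axis 2 1 \<noteq> (axis 3 1 :: real ^ 3)" "axis 3 1 \<noteq> (axis 1 1 :: real ^ 3)"
    by (simp_all add: axis_eq_axis)
  then show ?thesis by (auto simp: stage_vertex_def mod_Suc)
qed

lemma stage_index_measurable:
  "(\<lambda>t. stage_vertex (stage_index n T t)) \<in> borel_measurable (lebesgue_on S)"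
proof -
  have "(\<lambda>t. nat \<lfloor>t / T\<rfloor>) \<in> measurable lborel (count_space UNIV)"
    by measurable
  then have "(\<lambda>t. stage_vertex (min (nat \<lfloor>t / T\<rfloor>) n)) \<in> borel_measurable lborel"
    by (rule measurable_compose) simp
  then show ?thesis
    unfolding stage_index_def by (intro measurable_restrict_space1 measurable_completion)
qed

section \<open>The holonomy over all stages and the glued trajectory\<close>

locale smoothed_polygon = smoothed_stage +
  fixes k :: nat and \<theta> :: real
  assumes \<alpha>_\<theta>: "\<alpha> = 2 * cos \<theta>" and sin_\<theta>: "sin \<theta> \<noteq> 0"
    and \<theta>: "(3 * real k + 1) * \<theta> = real k * pi"
begin

abbreviation n where "n \<equiv> 3 * k"
abbreviation tf where "tf \<equiv> real (Suc n) * T"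
abbreviation piece where "piece m \<equiv> {real m * T..real (Suc m) * T}"
abbreviation u where "u t \<equiv> stage_vertex (stage_index n T t)"

text \<open>Closed form of the power M^m: the square of N = M - cos \<theta> is -(sin \<theta>)^2,
  so N / sin \<theta> acts as an imaginary unit and de Moivre's formula applies.\<close>

definition Mp where
  "Mp m = cos (real m * \<theta>) *\<^sub>R mat 1 + (sin (real m * \<theta>) / sin \<theta>) *\<^sub>R (M - cos \<theta> *\<^sub>R mat 1)"

lemma Mp_0: "Mp 0 = mat 1" by (simp add: Mp_def)

text \<open>The holonomy \<open>M\<close> is elliptic with eigenvalues \<open>exp (\<plusminus>\<i>\<theta>)\<close>.\<close>

lemma Mp_Suc: "Mp (Suc m) = Mp m ** M"
proof -
  define N where "N = (\<alpha> / 2 * (r * y)) *\<^sub>R C'"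
  have M: "M = cos \<theta> *\<^sub>R mat 1 + N"
  proof -
    have c: "cos \<theta> = \<alpha> / 2" using \<alpha>_\<theta> by simp
    show ?thesis unfolding c by (simp add: M_def N_def scaleR_add_right)
  qed
  have N: "N ** N = (- (sin \<theta> * sin \<theta>)) *\<^sub>R mat 1"
  proof -
    have "N ** N = ((\<alpha> / 2 * (r * y)) * (\<alpha> / 2 * (r * y)) * (- (2 + 3 * y * y - i * i) / 4)) *\<^sub>R mat 1"
      by (simp add: N_def C'_def mat2_simps i_def field_simps)
    \<comment> \<open>Grouped so that the relation \<alpha> (1 + 3 y^2) = 4 can be inserted.\<close>
    also have "(\<alpha> / 2 * (r * y)) * (\<alpha> / 2 * (r * y)) * (- (2 + 3 * y * y - i * i) / 4)
        = - (((\<alpha> * (1 + 3 * y * y)) * (\<alpha> * (1 + 3 * y * y)) - 4 * \<alpha> * \<alpha>) / 16)"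
      by (simp add: i_def field_simps rr_simps)
    also have "\<dots> = - (1 - cos \<theta> * cos \<theta>)"
      unfolding \<alpha>_y by (simp add: \<alpha>_\<theta> field_simps)
    also have "\<dots> = - (sin \<theta> * sin \<theta>)"
      using sin_cos_squared_add[of \<theta>] by (simp add: power2_eq_square)
    finally show ?thesis .
  qed
  interpret mm: bounded_bilinear "(**) :: mat2 \<Rightarrow> mat2 \<Rightarrow> mat2" by (rule bounded_bilinear_matrix_mult)
  have "Mp m ** M = (cos (real m * \<theta>) * cos \<theta>) *\<^sub>R mat 1 + cos (real m * \<theta>) *\<^sub>R N
      + ((sin (real m * \<theta>) / sin \<theta>) * cos \<theta>) *\<^sub>R N + (sin (real m * \<theta>) / sin \<theta>) *\<^sub>R (N ** N)"
    unfolding Mp_def M by (simp add: mm.add_left mm.add_right mm.scaleR_left mm.scaleR_right algebra_simps)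
  also have "\<dots> = (cos (real m * \<theta>) * cos \<theta> - sin (real m * \<theta>) * sin \<theta>) *\<^sub>R mat 1
      + ((cos (real m * \<theta>) * sin \<theta> + sin (real m * \<theta>) * cos \<theta>) / sin \<theta>) *\<^sub>R N"
    using sin_\<theta> unfolding N by (simp add: algebra_simps add_divide_distrib)
  also have "\<dots> = Mp (Suc m)"
    unfolding Mp_def M by (simp add: cos_add sin_add algebra_simps)
  finally show ?thesis by (rule sym)
qed

lemma Mp_final: "Mp (Suc n) = (-1) ^ k *\<^sub>R mat 1"
proof -
  have "real (Suc n) * \<theta> = real k * pi" using \<theta> by (simp add: algebra_simps)
  then show ?thesis by (simp add: Mp_def)
qed

lemma det_M: "det M = 1"
proof -
  have "det (G0 T) = det M * det R_mat" by (simp add: G0_T det_mul)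
  then show ?thesis by (simp add: det_G0 R_mat_eq)
qed

lemma det_Mp: "det (Mp m) = 1"
  by (induction m) (simp_all add: Mp_0 Mp_Suc det_mul det_M)

text \<open>The left factor accumulates the holonomies of the completed stages; the right factor is
  the rotation that conjugates X on stage m.\<close>

definition gH :: "nat \<Rightarrow> real \<Rightarrow> mat2" where
  "gH m s = Mp m ** G0 s ** Rot (real m * pi / 3)"

lemma gH_compat: "gH m T = gH (Suc m) 0"
proof -
  have "R_mat ** Rot (real m * pi / 3) = Rot (real (Suc m) * pi / 3)"
    unfolding R_mat_eq Rot_mult by (simp add: add_divide_distrib algebra_simps)
  then show ?thesis
    unfolding gH_def G0_T G0_0 Mp_Suc by (simp add: matrix_mul_assoc[symmetric])
qed

lemma conj_compat: "H T = conj_rot (Suc 0) (H 0) \<Longrightarrow> conj_rot m (H T) = conj_rot (Suc m) (H 0)"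
  by (simp add: conj_rot_conj_rot)

text \<open>The end of stage 3k is read as the start of stage 3k + 1, where g = M^(3k+1) R^(3k+1).
  Both M^(3k+1) and R^(3k) are (-1)^k times the identity, so the signs cancel and one factor R is
  left.\<close>

lemma gH_final: "gH n T = R_mat"
proof -
  interpret mm: bounded_bilinear "(**) :: mat2 \<Rightarrow> mat2 \<Rightarrow> mat2" by (rule bounded_bilinear_matrix_mult)
  have "real (Suc n) * pi / 3 = real k * pi + pi / 3" by (simp add: field_simps)
  then have "Rot (real (Suc n) * pi / 3) = (-1) ^ k *\<^sub>R R_mat"
    by (simp only: R_mat_eq Rot_mult[symmetric] Rot_nat_pi mm.scaleR_left matrix_mul_lid)
  then have "gH n T = (-1) ^ k *\<^sub>R (-1) ^ k *\<^sub>R R_mat"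
    unfolding gH_compat unfolding gH_def Mp_final G0_0 by (simp add: mm.scaleR_left mm.scaleR_right)
  then show ?thesis by (simp flip: power_mult_distrib)
qed

lemma der_gH: "(gH m has_vector_derivative gH m s ** conj_rot m (X0 s)) (at s within S)"
proof -
  interpret mm: bounded_bilinear "(**) :: mat2 \<Rightarrow> mat2 \<Rightarrow> mat2" by (rule bounded_bilinear_matrix_mult)
  have "(gH m has_vector_derivative
      Mp m ** G0 s ** 0 + (Mp m ** (G0 s ** X0 s) + 0 ** G0 s) ** Rot (real m * pi / 3)) (at s within S)"
    unfolding gH_def
    by (intro has_vector_derivative_matrix_mult der_G0 has_vector_derivative_const)
  also have "Mp m ** G0 s ** 0 + (Mp m ** (G0 s ** X0 s) + 0 ** G0 s) ** Rot (real m * pi / 3)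
      = gH m s ** conj_rot m (X0 s)"
    unfolding mm.zero_left mm.zero_right gH_def conj_rot_def add_0_left add_0_right
    by (simp only: matrix_mul_assoc[symmetric] Rot_cancel)
  finally show ?thesis .
qed

definition X_traj where "X_traj = glue n T (\<lambda>m s. conj_rot m (X0 s))"
definition g_traj where "g_traj = glue n T gH"

lemma shift_mem: "t \<in> piece m \<Longrightarrow> t - real m * T \<in> {0..T}"
  by (simp add: algebra_simps)

lemma glue_gH: "m \<le> n \<Longrightarrow> t \<in> piece m \<Longrightarrow> glue n T gH t = gH m (t - real m * T)"
  by (rule glue_eq[where H = gH]) (simp_all only: T_pos gH_compat)

lemma glue_conj:
  assumes "H T = conj_rot (Suc 0) (H 0)" "m \<le> n" "t \<in> piece m"
  shows "glue n T (\<lambda>m s. conj_rot m (H s)) t = conj_rot m (H (t - real m * T))"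
  by (rule glue_eq[where H = "\<lambda>m s. conj_rot m (H s)", OF T_pos assms(2,3) conj_compat[OF assms(1)]])

lemma der_glue_conj:
  assumes "H T = conj_rot (Suc 0) (H 0)" "m \<le> n" "t \<in> piece m"
    and "\<And>s S. (H has_vector_derivative H' s) (at s within S)"
  shows "(glue n T (\<lambda>m s. conj_rot m (H s)) has_vector_derivative conj_rot m (H' (t - real m * T)))
    (at t within piece m)"
  by (rule has_vector_derivative_glue[where H = "\<lambda>m s. conj_rot m (H s)" and H' = "\<lambda>s. conj_rot m (H' s)",
        OF T_pos assms(2,3) conj_compat[OF assms(1)]])
    (rule has_vector_derivative_conj_rot[OF assms(4)])

lemma trajectory_exists:
  assumes m: "m \<le> n" and t: "t \<in> piece m"
  shows "(g_traj has_vector_derivative (g_traj t ** X_traj t)) (at t within piece m)"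
    "(X_traj has_vector_derivative bracket (P_mat (stage_vertex m) (X_traj t)) (X_traj t)) (at t within piece m)"
proof -
  let ?s = "t - real m * T"
  have g: "g_traj t = gH m ?s"
    unfolding g_traj_def by (rule glue_gH[OF m t])
  have X: "X_traj t = conj_rot m (X0 ?s)"
    unfolding X_traj_def by (rule glue_conj[OF X0_T m t])
  show "(g_traj has_vector_derivative (g_traj t ** X_traj t)) (at t within piece m)"
    unfolding g X unfolding g_traj_def
    by (rule has_vector_derivative_glue[where H = gH and H' = "\<lambda>s. gH m s ** conj_rot m (X0 s)",
          OF T_pos m t gH_compat der_gH])
  have "(X_traj has_vector_derivative conj_rot m (bracket P0 (X0 ?s))) (at t within piece m)"
    unfolding X_traj_def by (rule der_glue_conj[OF X0_T m t der_X0])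
  then show "(X_traj has_vector_derivative bracket (P_mat (stage_vertex m) (X_traj t)) (X_traj t)) (at t within piece m)"
    unfolding X by (simp add: P_mat_stage bracket_conj_rot P_mat_X0)
qed

lemma trajectory_0: "g_traj 0 = mat 1" "X_traj 0 = X0 0"
proof -
  have "0 \<in> piece 0" using T_pos by simp
  then show "g_traj 0 = mat 1" "X_traj 0 = X0 0"
    unfolding g_traj_def X_traj_def
    using glue_gH[of 0 0] glue_conj[OF X0_T, of 0 0]
    by (simp_all add: gH_def Mp_0 G0_0 Rot_zero)
qed

text \<open>Rotating stage m back turns its active vertex into e3, so uniqueness on the first stage
  applies; the endpoint shared by consecutive stages passes the initial values on.\<close>

lemma trajectory_unique:
  fixes g X :: "real \<Rightarrow> mat2"
  assumes init: "g 0 = mat 1" "X 0 = X0 0"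
    and ode: "\<forall>m\<le>n. \<forall>t\<in>piece m. (g has_vector_derivative (g t ** X t)) (at t within piece m) \<and>
      (X has_vector_derivative bracket (P_mat (stage_vertex m) (X t)) (X t)) (at t within piece m)"
    and m: "m \<le> n"
  shows "\<forall>s\<in>{0..T}. X (real m * T + s) = conj_rot m (X0 s) \<and> g (real m * T + s) = gH m s"
proof -
  interpret mm: bounded_bilinear "(**) :: mat2 \<Rightarrow> mat2 \<Rightarrow> mat2" by (rule bounded_bilinear_matrix_mult)
  have g: "(g has_vector_derivative (g t ** X t)) (at t within piece m)"
    and X: "(X has_vector_derivative bracket (P_mat (stage_vertex m) (X t)) (X t)) (at t within piece m)"
    if "m \<le> n" "t \<in> piece m" for m t
    using ode that by blast+
  have step: "\<forall>s\<in>{0..T}. X (real m * T + s) = conj_rot m (X0 s) \<and> g (real m * T + s) = gH m s"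
    if m: "m \<le> n" and Xm: "X (real m * T) = conj_rot m (X0 0)" and gm: "g (real m * T) = gH m 0" for m
  proof
    fix s assume s: "s \<in> {0..T}"
    \<comment> \<open>rotate stage \<open>m\<close> back to stage \<open>0\<close>; \<open>conj_rot (2 * m)\<close> is the inverse of \<open>conj_rot m\<close>\<close>
    define Y where "Y s = conj_rot (2 * m) (X (real m * T + s))" for s
    \<comment> \<open>The constant right factor turns g' = g X into h' = h Y for the rotated
      state.\<close>
    define h where "h s = g (real m * T + s) ** Rot (- (real m * pi / 3))" for s
    have XY: "X (real m * T + s) = conj_rot m (Y s)" for s
      using conj_rot_triple[of m] by (simp add: Y_def conj_rot_conj_rot)
    have inv: "conj_rot (2 * m) (conj_rot m A) = A" for A
      using conj_rot_triple[of m] by (simp add: conj_rot_conj_rot)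
    have mem: "real m * T + s \<in> piece m" if "s \<in> {0..T}" for s
      using that by (simp add: algebra_simps)
    have shift: "((\<lambda>s. f (real m * T + s)) has_vector_derivative D) (at s within {0..T})"
      if "(f has_vector_derivative D) (at (real m * T + s) within piece m)" for f :: "real \<Rightarrow> mat2" and D s
    proof -
      have "((\<lambda>s. real m * T + s) has_vector_derivative 1) (at s within {0..T})"
        by (rule derivative_eq_intros | simp)+
      moreover have "(f has_vector_derivative D) (at (real m * T + s) within (\<lambda>s. real m * T + s) ` {0..T})"
        by (rule has_vector_derivative_within_subset[OF that]) (use mem in blast)
      ultimately show ?thesis
        using vector_diff_chain_within[of "\<lambda>s. real m * T + s" 1 s "{0..T}" f D] by (simp add: o_def)
    qed
    have dY: "(Y has_vector_derivative bracket (P_mat (axis 3 1) (Y s)) (Y s)) (at s within {0..T})"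
      if s: "s \<in> {0..T}" for s
    proof -
      have "(Y has_vector_derivative conj_rot (2 * m)
          (bracket (P_mat (stage_vertex m) (X (real m * T + s))) (X (real m * T + s)))) (at s within {0..T})"
        unfolding Y_def by (rule has_vector_derivative_conj_rot[OF shift[OF X[OF m mem[OF s]]]])
      then show ?thesis by (simp only: XY P_mat_stage bracket_conj_rot inv)
    qed
    have dh: "(h has_vector_derivative h s ** Y s) (at s within {0..T})" if s: "s \<in> {0..T}" for s
    proof -
      have "(h has_vector_derivative g (real m * T + s) ** 0
          + (g (real m * T + s) ** X (real m * T + s)) ** Rot (- (real m * pi / 3))) (at s within {0..T})"
        unfolding h_def
        by (rule has_vector_derivative_matrix_mult[OF shift[OF g[OF m mem[OF s]]] has_vector_derivative_const])
      also have "g (real m * T + s) ** 0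
          + (g (real m * T + s) ** X (real m * T + s)) ** Rot (- (real m * pi / 3)) = h s ** Y s"
        unfolding XY mm.zero_right add_0_left h_def conj_rot_def
        by (simp only: matrix_mul_assoc[symmetric] Rot_inverse matrix_mul_rid)
      finally show ?thesis .
    qed
    have Y0: "Y 0 = X0 0" by (simp add: Y_def Xm inv)
    have h0: "h 0 = Mp m"
      unfolding h_def add_0_right gm gH_def G0_0 matrix_mul_rid
      by (simp only: matrix_mul_assoc[symmetric] Rot_inverse matrix_mul_rid)
    note uniq = base_uniqueness[OF dY dh Y0 s]
    have "X (real m * T + s) = conj_rot m (X0 s)" by (subst XY) (rule arg_cong[OF uniq(1)])
    moreover have "g (real m * T + s) = h s ** Rot (real m * pi / 3)"
      unfolding h_def by (simp only: matrix_mul_assoc[symmetric] Rot_inverse matrix_mul_rid)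
    then have "g (real m * T + s) = gH m s"
      by (simp only: uniq(2) h0 gH_def)
    ultimately show "X (real m * T + s) = conj_rot m (X0 s) \<and> g (real m * T + s) = gH m s" ..
  qed
  show ?thesis
    using m
  proof (induction m)
    case 0
    show ?case using step[of 0] init by (simp add: gH_def Mp_0 G0_0 Rot_zero)
  next
    case (Suc m)
    have T: "T \<in> {0..T}" using T_pos by simp
    have Suc_T: "real (Suc m) * T = real m * T + T" by (simp add: algebra_simps)
    have IH: "X (real (Suc m) * T) = conj_rot m (X0 T)" "g (real (Suc m) * T) = gH m T"
      using Suc T unfolding Suc_T by simp_all
    show ?case
      by (rule step[OF Suc.prems]) (simp_all only: IH conj_compat[OF X0_T] gH_compat)
  qed
qed

section \<open>The extremal on the whole time interval\<close>

lemma continuous_on_stage [continuous_intros]: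
  "continuous_on S X0" "continuous_on S L0" "continuous_on S LR0" "continuous_on S Q"
  by (rule continuous_on_vector_derivative, rule der_X0 der_L0 der_LR0 der_Q)+

lemmas matrix_continuous_intros [continuous_intros] =
  bounded_bilinear.continuous_on[OF bounded_bilinear_matrix_mult]
  bounded_bilinear.continuous_on[OF bounded_bilinear_bracket]
  bounded_bilinear.continuous_on[OF bounded_bilinear_trace_form]

lemma continuous_on_conj_rot:
  fixes H' :: "real \<Rightarrow> mat2"
  assumes "continuous_on UNIV H'"
  shows "continuous_on S (\<lambda>t. conj_rot m (H' (t - c)))"
proof -
  have "continuous_on UNIV (conj_rot m)"
    by (rule linear_continuous_on[OF linear_conv_bounded_linear[THEN iffD1, OF conj_rot_linear]])
  moreover have "continuous_on S (\<lambda>t. H' (t - c))"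
    by (rule continuous_on_compose2[OF assms]) (auto intro!: continuous_intros)
  ultimately show ?thesis by (rule continuous_on_compose2) simp
qed

lemma abs_cont_glue:
  assumes "H T = conj_rot (Suc 0) (H 0)"
    and "\<And>s S. (H has_vector_derivative H' s) (at s within S)" and "continuous_on UNIV H'"
  shows "abs_cont_on (glue n T (\<lambda>m s. conj_rot m (H s))) {0..tf}"
proof (rule piecewise_C1_imp_abs_cont_on[where f' = "\<lambda>m t. conj_rot m (H' (t - real m * T))"])
  show "0 \<le> T" using T_pos by simp
  show "continuous_on (piece m) (\<lambda>t. conj_rot m (H' (t - real m * T)))" for m
    by (rule continuous_on_conj_rot[OF assms(3)])
qed (rule der_glue_conj[OF assms(1) _ _ assms(2)])

text \<open>Since J is fixed by the rotations, Q rotates with the stages, and so does every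
  condition of the maximum principle; each reduces to the first stage. The value -1 for the cost
  multiplier also settles nontriviality.\<close>

lemma pontryagin:
  fixes g X :: "real \<Rightarrow> mat2"
  assumes init: "g 0 = mat 1" "X 0 = X0 0"
    and ode: "\<forall>m\<le>n. \<forall>t\<in>piece m. (g has_vector_derivative (g t ** X t)) (at t within piece m) \<and>
      (X has_vector_derivative bracket (P_mat (stage_vertex m) (X t)) (X t)) (at t within piece m)"
  defines "L1 \<equiv> glue n T (\<lambda>m s. conj_rot m (L0 s))" and "LR \<equiv> glue n T (\<lambda>m s. conj_rot m (LR0 s))"
  shows "g tf = R_mat" "X tf = matrix_inv R_mat ** X 0 ** R_mat"
    "pontryagin_extremal tf (\<lambda>t. u t) g X L1 LR (- 1)" "transversality tf L1 LR"
proof -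
  have g: "(g has_vector_derivative (g t ** X t)) (at t within piece m)"
    and X: "(X has_vector_derivative bracket (P_mat (stage_vertex m) (X t)) (X t)) (at t within piece m)"
    if "m \<le> n" "t \<in> piece m" for m t
    using ode that by blast+
  have tf: "tf = real n * T + T" "tf \<in> piece n" "tf - real n * T = T"
    using T_pos by (simp_all add: algebra_simps)
  have tf_pos: "tf > 0" using T_pos by simp
  have p0: "0 \<in> piece 0" using T_pos by simp
  have Xg: "X t = conj_rot m (X0 (t - real m * T))" "g t = gH m (t - real m * T)"
    if "m \<le> n" "t \<in> piece m" for m t
  proof -
    have "real m * T + (t - real m * T) = t" by simp
    then show "X t = conj_rot m (X0 (t - real m * T))" "g t = gH m (t - real m * T)"
      using bspec[OF trajectory_unique[OF init ode that(1)] shift_mem[OF that(2)]] by simp_all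
  qed
  have L1: "L1 t = conj_rot m (L0 (t - real m * T))" if "m \<le> n" "t \<in> piece m" for m t
    unfolding L1_def by (rule glue_conj[OF L0_T that])
  have LR: "LR t = conj_rot m (LR0 (t - real m * T))" if "m \<le> n" "t \<in> piece m" for m t
    unfolding LR_def by (rule glue_conj[OF LR0_T that])
  have rot: "conj_rot n A = A" for A by (rule conj_rot_triple)
  show gtf: "g tf = R_mat"
    using Xg(2)[OF order_refl tf(2)] unfolding tf(3) gH_final .
  show Xtf: "X tf = matrix_inv R_mat ** X 0 ** R_mat"
    using Xg(1)[OF order_refl tf(2)] unfolding tf(3) rot X0_T conj_rot_one init(2) .
  have L1_0: "L1 0 = L0 0" and LR_0: "LR 0 = LR0 0"
    using L1[OF _ p0] LR[OF _ p0] by simp_all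
  have "L1 tf = matrix_inv R_mat ** L1 0 ** R_mat"
    using L1[OF order_refl tf(2)] unfolding tf(3) rot L0_T conj_rot_one L1_0 .
  moreover have "LR tf = matrix_inv R_mat ** LR 0 ** R_mat"
    using LR[OF order_refl tf(2)] unfolding tf(3) rot LR0_T conj_rot_one LR_0 .
  ultimately show "transversality tf L1 LR" by (simp only: transversality_def)

  have pieceE: "\<exists>m\<le>n. t \<in> piece m" if "t \<in> {0..tf}" for t
    using piece_exists[OF T_pos that] by blast
  have Z_neg: "trace_form (X t) (Z_mat (axis j 1)) < 0" if "m \<le> n" "t \<in> piece m" for m t j
  proof -
    obtain j' where "Z_mat (axis j 1) = conj_rot m (Z_mat (axis j' 1))" using Z_mat_eq_conj_rot by blast
    then show ?thesis using X0_Z_neg[OF shift_mem[OF that(2)]] by (simp only: Xg(1)[OF that] trace_form_conj_rot)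
  qed
  \<comment> \<open>With the constant P inserted, the continuity of the derivative in t is
    evident.\<close>
  have der_X': "(X has_vector_derivative conj_rot m (bracket P0 (X0 (t - real m * T)))) (at t within piece m)"
    if "m \<le> n" "t \<in> piece m" for m t
    using X[OF that] by (simp only: Xg(1)[OF that] P_mat_stage bracket_conj_rot P_mat_X0)
  have acX: "abs_cont_on X {0..tf}"
    proof (rule piecewise_C1_imp_abs_cont_on[OF less_imp_le[OF T_pos]])
    show "continuous_on (piece m) (\<lambda>t. conj_rot m (bracket P0 (X0 (t - real m * T))))" for m
      by (intro continuous_on_conj_rot continuous_intros)
  qed (rule der_X')
  have acg: "abs_cont_on g {0..tf}"
  proof (rule piecewise_C1_imp_abs_cont_on[OF less_imp_le[OF T_pos]])
    show "(g has_vector_derivative g t ** X t) (at t within piece m)" if "m \<le> n" "t \<in> piece m" for m t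
      by (rule g[OF that])
    fix m assume m: "m \<le> n"
    have "continuous_on (piece m) g" "continuous_on (piece m) X"
      by (rule continuous_on_vector_derivative, erule g[OF m] X[OF m])+
    then show "continuous_on (piece m) (\<lambda>t. g t ** X t)" by (intro continuous_intros)
  qed
  have acL1: "abs_cont_on L1 {0..tf}"
    unfolding L1_def by (rule abs_cont_glue[OF L0_T der_L0]) (intro continuous_intros)
  have acLR: "abs_cont_on LR {0..tf}"
    unfolding LR_def
    by (rule abs_cont_glue[OF LR0_T der_LR0]) (unfold LR0'_def, intro continuous_intros)
  have open_closed: "t \<in> piece m" if "t \<in> {real m * T<..<real (Suc m) * T}" for t m
    using that unfolding greaterThanLessThan_iff atLeastAtMost_iff by linarith
  have u: "u t = stage_vertex m" if "m \<le> n" "t \<in> {real m * T<..<real (Suc m) * T}" for m t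
  proof -
    have "stage_index n T t = m"
      using that unfolding greaterThanLessThan_iff by (intro stage_index_eq T_pos) simp_all
    then show ?thesis by simp
  qed
  have adm: "reinhardt_admissible tf (\<lambda>t. u t) g X"
    unfolding reinhardt_admissible_def
  proof (intro conjI ballI)
    show "0 < tf" by (fact tf_pos)
    show "(\<lambda>t. u t) \<in> borel_measurable (lebesgue_on {0..tf})" by (rule stage_index_measurable)
    show "u t \<in> U_T" for t by (rule stage_vertex_U_T)
    show "abs_cont_on g {0..tf}" "abs_cont_on X {0..tf}" by fact+
    show "g t \<in> SL2" if t: "t \<in> {0..tf}" for t
    proof -
      obtain m where m: "m \<le> n" "t \<in> piece m" using pieceE[OF t] by blast
      show ?thesis by (simp add: Xg(2)[OF m] gH_def SL2_def det_mul det_Mp det_G0)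
    qed
    show "\<exists>z\<in>h_star. X t = Phi z" if t: "t \<in> {0..tf}" for t
    proof -
      obtain m where m: "m \<le> n" "t \<in> piece m" using pieceE[OF t] by blast
      show ?thesis
        by (rule Phi_h_starI[OF _ _ Z_neg[OF m]]) (simp_all add: Xg(1)[OF m] tr_X0 det_X0)
    qed
    show "AE t in lebesgue_on {0..tf}. (g has_vector_derivative g t ** X t) (at t within {0..tf})"
      by (rule AE_piecewise[OF T_pos], rule has_vector_derivative_piece_interior[OF g[OF _ open_closed] _ _ T_pos])
    show "AE t in lebesgue_on {0..tf}.
        (X has_vector_derivative bracket (P_mat (u t) (X t)) (X t)) (at t within {0..tf})"
    proof (rule AE_piecewise[OF T_pos])
      fix m t assume m: "m \<le> n" and t: "t \<in> {real m * T<..<real (Suc m) * T}"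
      show "(X has_vector_derivative bracket (P_mat (u t) (X t)) (X t)) (at t within {0..tf})"
        unfolding u[OF m t]
        by (rule has_vector_derivative_piece_interior[OF X[OF m open_closed[OF t]] t m T_pos])
    qed
    show "g 0 = mat 1" "g tf = R_mat" "X tf = matrix_inv R_mat ** X 0 ** R_mat" by fact+
  qed
  have Q: "L1 t - (3 / 2 * - 1) *\<^sub>R J_mat = conj_rot m (Q (t - real m * T))"
    if "m \<le> n" "t \<in> piece m" for m t
    by (simp add: L1[OF that] Q_def conj_rot_add conj_rot_scale)
  have Q': "- L1 t + (3 / 2 * - 1) *\<^sub>R J_mat = conj_rot m (- Q (t - real m * T))"
    if "m \<le> n" "t \<in> piece m" for m t
    by (simp add: L1[OF that] Q_def conj_rot_add conj_rot_scale conj_rot_neg conj_rot_diff)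
  have ham: "hamiltonian (- 1) (L1 t) (LR t) (X t) v =
      q (t - real m * T) - trace_form (LR t) (Z_mat v) / trace_form (X t) (Z_mat v)"
    if "m \<le> n" "t \<in> piece m" for m t v
    unfolding hamiltonian_def Q[OF that] by (simp add: Xg(1)[OF that] Q_X0)
  show "pontryagin_extremal tf (\<lambda>t. u t) g X L1 LR (- 1)"
    unfolding pontryagin_extremal_def Let_def
  proof (intro conjI ballI)
    show "reinhardt_admissible tf (\<lambda>t. u t) g X" by (fact adm)
    show "abs_cont_on L1 {0..tf}" "abs_cont_on LR {0..tf}" by fact+
    show "(- 1 :: real) \<le> 0" by simp
    show "(- 1 :: real, L1 t, LR t) \<noteq> (0, 0, 0)" for t by simp
    show "L1 t \<in> sl2" "LR t \<in> sl2" "trace_form (LR t) (X t) = 0" if t: "t \<in> {0..tf}" for t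
    proof -
      obtain m where m: "m \<le> n" "t \<in> piece m" using pieceE[OF t] by blast
      show "L1 t \<in> sl2" "LR t \<in> sl2" "trace_form (LR t) (X t) = 0"
        by (simp_all add: L1[OF m] LR[OF m] Xg(1)[OF m] sl2_def tr_L0 tr_LR0 LR0_X0)
    qed
    show "AE t in lebesgue_on {0..tf}. (L1 has_vector_derivative bracket (L1 t) (X t)) (at t within {0..tf})"
    proof (rule AE_piecewise[OF T_pos])
      fix m t assume m: "m \<le> n" and t: "t \<in> {real m * T<..<real (Suc m) * T}"
      have "(L1 has_vector_derivative conj_rot m (bracket (L0 (t - real m * T)) (X0 (t - real m * T)))) (at t within piece m)"
        unfolding L1_def by (rule der_glue_conj[OF L0_T m open_closed[OF t] der_L0])
      then have "(L1 has_vector_derivative bracket (L1 t) (X t)) (at t within piece m)"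
        by (simp only: L1[OF m open_closed[OF t]] Xg(1)[OF m open_closed[OF t]] bracket_conj_rot)
      then show "(L1 has_vector_derivative bracket (L1 t) (X t)) (at t within {0..tf})"
        by (rule has_vector_derivative_piece_interior[OF _ t m T_pos])
    qed
    show "AE t in lebesgue_on {0..tf}.
      (LR has_vector_derivative
        bracket (P_mat (u t) (X t)) (LR t) - trace_form (LR t) (P_mat (u t) (X t)) *\<^sub>R bracket (P_mat (u t) (X t)) (X t)
         + bracket (- L1 t + (3 / 2 * - 1) *\<^sub>R J_mat) (X t)) (at t within {0..tf})"
    proof (rule AE_piecewise[OF T_pos])
      fix m t assume m: "m \<le> n" and t: "t \<in> {real m * T<..<real (Suc m) * T}"
      note t' = open_closed[OF t]
      have "(LR has_vector_derivative conj_rot m (LR0' (t - real m * T))) (at t within piece m)"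
        unfolding LR_def by (rule der_glue_conj[OF LR0_T m t' der_LR0])
      also have "conj_rot m (LR0' (t - real m * T)) =
          bracket (P_mat (u t) (X t)) (LR t) - trace_form (LR t) (P_mat (u t) (X t)) *\<^sub>R bracket (P_mat (u t) (X t)) (X t)
          + bracket (- L1 t + (3 / 2 * - 1) *\<^sub>R J_mat) (X t)"
        unfolding Q'[OF m t'] u[OF m t] Xg(1)[OF m t'] LR[OF m t'] P_mat_stage P_mat_X0 bracket_conj_rot
          trace_form_conj_rot
        by (simp only: LR0'_def conj_rot_add conj_rot_diff conj_rot_scale)
      finally show "(LR has_vector_derivative
        bracket (P_mat (u t) (X t)) (LR t) - trace_form (LR t) (P_mat (u t) (X t)) *\<^sub>R bracket (P_mat (u t) (X t)) (X t)
         + bracket (- L1 t + (3 / 2 * - 1) *\<^sub>R J_mat) (X t)) (at t within {0..tf})"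
        by (rule has_vector_derivative_piece_interior[OF _ t m T_pos])
    qed
    show "AE t in lebesgue_on {0..tf}.
        (\<forall>v\<in>U_T. hamiltonian (- 1) (L1 t) (LR t) (X t) v \<le> hamiltonian (- 1) (L1 t) (LR t) (X t) (u t)) \<and>
        hamiltonian (- 1) (L1 t) (LR t) (X t) (u t) = 0"
    proof (rule AE_piecewise[OF T_pos])
      fix m t assume m: "m \<le> n" and t: "t \<in> {real m * T<..<real (Suc m) * T}"
      note t' = open_closed[OF t]
      let ?s = "t - real m * T"
      have zero: "hamiltonian (- 1) (L1 t) (LR t) (X t) (u t) = 0"
      proof -
        have "trace_form (X0 ?s) (Z_mat (axis 3 1)) < 0" by (rule X0_Z_neg[OF shift_mem[OF t']])
        then show ?thesis
          using hamiltonian_stationary[of ?s]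
          unfolding u[OF m t] ham[OF m t']
          unfolding Xg(1)[OF m t'] LR[OF m t'] Z_mat_stage trace_form_conj_rot
          by (simp add: field_simps)
      qed
      have "hamiltonian (- 1) (L1 t) (LR t) (X t) v \<le> 0" if "v \<in> U_T" for v
        unfolding ham[OF m t']
      proof (rule hamiltonian_nonpos[OF Z_neg[OF m t'] _ that])
        fix j
        obtain j' where j': "Z_mat (axis j 1) = conj_rot m (Z_mat (axis j' 1))" using Z_mat_eq_conj_rot by blast
        show "0 \<le> q ?s * trace_form (X t) (Z_mat (axis j 1)) - trace_form (LR t) (Z_mat (axis j 1))"
          using hamiltonian_max[OF shift_mem[OF t'], of j']
          unfolding j' Xg(1)[OF m t'] LR[OF m t'] trace_form_conj_rot .
      qed
      then show "(\<forall>v\<in>U_T. hamiltonian (- 1) (L1 t) (LR t) (X t) v \<le> hamiltonian (- 1) (L1 t) (LR t) (X t) (u t)) \<and>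
          hamiltonian (- 1) (L1 t) (LR t) (X t) (u t) = 0"
        using zero by simp
    qed
  qed
qed

lemma bang_bang_u: "bang_bang tf (\<lambda>t. u t)"
  unfolding bang_bang_def
proof (intro conjI ballI exI allI impI)
  show "u t \<in> U_T_vertices" for t by (rule stage_vertex_U_T)
  show "real 0 * T = 0" "real (Suc n) * T = tf" by simp_all
  show "real i * T < real (Suc i) * T" for i using T_pos by simp
  show "u t = stage_vertex i" if "i < Suc n" "t \<in> {real i * T<..<real (Suc i) * T}" for i t
  proof -
    have "stage_index n T t = i"
      using that unfolding greaterThanLessThan_iff by (intro stage_index_eq T_pos) simp_all
    then show ?thesis by simp
  qed
  show "stage_vertex i \<noteq> stage_vertex (Suc i)" for i by (rule stage_vertex_Suc_neq)
qed

end

text \<open>\<open>y_init\<close> is a definite description, so unique existence comes first. With c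
  = cos \<theta> the equation reads y^2 = (2 / c - 1) / 3, and 1/3 < y^2 < 1 corresponds to 1/2 < c
  < 1, that is, to 0 < \<theta> < pi / 3.\<close>

lemma y_init_props:
  assumes "k \<ge> 1"
  defines "y \<equiv> y_init k"
  shows "0 < y" "4 / (3 * y\<^sup>2 + 1) = 2 * cos (theta k)"
    "1 < 2 * cos (theta k)" "2 * cos (theta k) < 2" "sin (theta k) \<noteq> 0"
proof -
  define c where "c = cos (theta k)"
  have pos: "0 < theta k" and less: "theta k < pi / 3"
    using assms by (simp_all add: theta_def field_simps)
  have "cos (pi / 3) < cos (theta k)"
    using pos less by (intro cos_monotone_0_pi) simp_all
  then have c1: "1 < 2 * c" by (simp add: cos_60 c_def)
  have "cos (theta k) < cos 0"
    using pos less by (intro cos_monotone_0_pi) simp_all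
  then have c2: "c < 1" by (simp add: c_def)
  show "1 < 2 * cos (theta k)" "2 * cos (theta k) < 2" using c1 c2 by (simp_all add: c_def)
  show "sin (theta k) \<noteq> 0" using sin_gt_zero[OF pos] less pi_gt_zero by linarith
  have iff: "4 / (3 * z\<^sup>2 + 1) = 2 * c \<longleftrightarrow> z\<^sup>2 = (2 / c - 1) / 3" for z :: real
  proof -
    have "3 * z\<^sup>2 + 1 > 0" by (simp add: add_nonneg_pos)
    then show ?thesis using c1 by (simp add: field_simps) (rule iffI; linarith)
  qed
  have bounds: "1 / 3 < (2 / c - 1) / 3" "(2 / c - 1) / 3 < 1"
    using c1 c2 by (simp_all add: field_simps)
  have "\<exists>!y. 1 / sqrt 3 < y \<and> y < 1 \<and> 4 / (3 * y\<^sup>2 + 1) = 2 * cos (theta k)"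
  proof (rule ex1I[of _ "sqrt ((2 / c - 1) / 3)"])
    have "sqrt (1 / 3) < sqrt ((2 / c - 1) / 3)" "sqrt ((2 / c - 1) / 3) < sqrt 1"
      using bounds by (simp_all only: real_sqrt_less_iff)
    then have "1 / sqrt 3 < sqrt ((2 / c - 1) / 3)" "sqrt ((2 / c - 1) / 3) < 1"
      by (simp_all only: real_sqrt_divide real_sqrt_one)
    moreover have "(sqrt ((2 / c - 1) / 3))\<^sup>2 = (2 / c - 1) / 3"
      using bounds by (intro real_sqrt_pow2) simp
    ultimately show "1 / sqrt 3 < sqrt ((2 / c - 1) / 3) \<and> sqrt ((2 / c - 1) / 3) < 1 \<and>
        4 / (3 * (sqrt ((2 / c - 1) / 3))\<^sup>2 + 1) = 2 * cos (theta k)"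
      using iffD2[OF iff] unfolding c_def by blast
  next
    fix z assume z: "1 / sqrt 3 < z \<and> z < 1 \<and> 4 / (3 * z\<^sup>2 + 1) = 2 * cos (theta k)"
    have "0 < 1 / sqrt (3 :: real)" by simp
    then have "z > 0" using z by linarith
    moreover have "z\<^sup>2 = (2 / c - 1) / 3" using z iff by (simp only: c_def)
    ultimately show "z = sqrt ((2 / c - 1) / 3)" by (metis less_imp_le real_sqrt_unique)
  qed
  from theI'[OF this] have y: "1 / sqrt 3 < y \<and> y < 1 \<and> 4 / (3 * y\<^sup>2 + 1) = 2 * cos (theta k)"
    by (simp only: y_def y_init_def)
  have "0 < 1 / sqrt (3 :: real)" by simp
  then show "0 < y" "4 / (3 * y\<^sup>2 + 1) = 2 * cos (theta k)" using y by linarith+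
qed

text \<open>\<open>polygon_trajectory\<close> determines g and X only on the time interval, so the
  claim ranges over all such pairs; the existence half keeps it from being vacuous.\<close>

theorem theorem7p5p6:
  fixes k :: nat
  assumes "k \<ge> 1"
  shows "(\<exists>g X. polygon_trajectory k g X) \<and>
    (\<forall>g X. polygon_trajectory k g X \<longrightarrow>
       g 0 = mat 1 \<and> g (t_final k) = R_mat \<and>
       X (t_final k) = matrix_inv R_mat ** X 0 ** R_mat \<and>
       bang_bang (t_final k) (polygon_control k) \<and>
       (\<exists>L1 LR lcost.
          pontryagin_extremal (t_final k) (polygon_control k) g X L1 LR lcost \<and>
          transversality (t_final k) L1 LR))"
proof -
  note props = y_init_props[OF assms]
  let ?y = "y_init k" and ?\<alpha> = "2 * cos (theta k)"
  have "(3 * ?y\<^sup>2 + 1) * ?\<alpha> = 4"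
  proof -
    have "3 * ?y\<^sup>2 + 1 > 0" by (simp add: add_nonneg_pos)
    then have "3 * ?y\<^sup>2 + 1 \<noteq> 0" by linarith
    then show ?thesis
      unfolding props(2)[symmetric] times_divide_eq_right by (rule nonzero_mult_div_cancel_left)
  qed
  then have y_\<alpha>: "3 * ?y\<^sup>2 * ?\<alpha> = 4 - ?\<alpha>" by (simp add: algebra_simps)
  have \<theta>: "(3 * real k + 1) * theta k = real k * pi"
  proof -
    have "3 * real k + 1 \<noteq> 0" by linarith
    then show ?thesis by (simp add: theta_def)
  qed
  interpret smoothed_polygon ?y ?\<alpha> k "theta k"
    by unfold_locales (use props y_\<alpha> \<theta> in simp_all)
  have T: "t_switch k = T" by (simp only: t_switch_def T_def r_def props(2))
  have tf: "t_final k = tf" by (simp only: t_final_def T) simp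
  have u: "polygon_control k = (\<lambda>t. u t)"
    by (rule ext) (simp only: polygon_control_def stage_index_def T)
  have traj: "polygon_trajectory k g X \<longleftrightarrow> g 0 = mat 1 \<and> X 0 = X0 0 \<and>
      (\<forall>m\<le>n. \<forall>t\<in>piece m. (g has_vector_derivative (g t ** X t)) (at t within piece m) \<and>
        (X has_vector_derivative bracket (P_mat (stage_vertex m) (X t)) (X t)) (at t within piece m))" for g X
    by (simp only: polygon_trajectory_def T X0_0)
  have "polygon_trajectory k g_traj X_traj"
    unfolding traj using trajectory_0 trajectory_exists by blast
  moreover have "g 0 = mat 1 \<and> g (t_final k) = R_mat \<and>
       X (t_final k) = matrix_inv R_mat ** X 0 ** R_mat \<and>
       bang_bang (t_final k) (polygon_control k) \<and>
       (\<exists>L1 LR lcost.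
          pontryagin_extremal (t_final k) (polygon_control k) g X L1 LR lcost \<and>
          transversality (t_final k) L1 LR)"
    if "polygon_trajectory k g X" for g X
  proof -
    have init: "g 0 = mat 1" "X 0 = X0 0"
      and ode: "\<forall>m\<le>n. \<forall>t\<in>piece m. (g has_vector_derivative (g t ** X t)) (at t within piece m) \<and>
        (X has_vector_derivative bracket (P_mat (stage_vertex m) (X t)) (X t)) (at t within piece m)"
      using that unfolding traj by blast+
    show ?thesis
      unfolding tf u using init(1) pontryagin[OF init ode] bang_bang_u by blast
  qed
  ultimately show ?thesis by blast
qed

end
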